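(* Let $\Omega=\mathbf{R}^d\setminus\{0\}$, $\delta\in[0,2)$, $c_\Omega(x)=|x|^\delta$, $d_\Gamma(x)=|x|$, and $H=-\mathrm{div}(c_\Omega\nabla)$ on $C_c^2(\Omega)$. Then for all $p>1$ for which $d+p\,\delta-2p>0$, the optimal constant $$\nu_p(\Omega)=\inf\Big\{\int_\Omega|H\varphi|^p\Big/\int_\Omega c_\Omega^{\,p}\,d_\Gamma^{\,-2p}\,|\varphi|^p:\ \varphi\in C_c^2(\Omega),\ \varphi\neq0\Big\}$$ in the weighted Rellich inequality on $\Omega$ is given by $$\nu_p(\Omega)=\big((p-1)\,d\,(d+p\,\delta-2p)\,p^{-2}\big)^p.$$
   Context: All functions are real-valued. $H\varphi=-\sum_{k=1}^d\partial_k(c_\Omega\,\partial_k\varphi)$. *)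

theory Defs
  imports "HOL-Analysis.Analysis"
begin

definition partial :: "'a::euclidean_space \<Rightarrow> ('a \<Rightarrow> real) \<Rightarrow> 'a \<Rightarrow> real" where
  "partial k f x = deriv (\<lambda>t. f (x + t *\<^sub>R k)) 0"

definition C1_on :: "'a::euclidean_space set \<Rightarrow> ('a \<Rightarrow> real) \<Rightarrow> bool" where
  "C1_on S f \<longleftrightarrow>
     (\<forall>x\<in>S. f differentiable (at x)) \<and> (\<forall>k\<in>Basis. continuous_on S (partial k f))"

definition C2_on :: "'a::euclidean_space set \<Rightarrow> ('a \<Rightarrow> real) \<Rightarrow> bool" where
  "C2_on S f \<longleftrightarrow> C1_on S f \<and> (\<forall>k\<in>Basis. C1_on S (partial k f))"

text \<open>Functions on \<open>\<Omega>\<close> are represented by their extension by zero to the whole space; the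
  support condition forces the value \<open>0\<close> off \<open>\<Omega>\<close>.\<close>

definition C2c :: "'a::euclidean_space set \<Rightarrow> ('a \<Rightarrow> real) set" where
  "C2c \<Omega> = {\<phi>. C2_on \<Omega> \<phi> \<and> compact (closure {x. \<phi> x \<noteq> 0}) \<and> closure {x. \<phi> x \<noteq> 0} \<subseteq> \<Omega>}"

definition div_op :: "('a::euclidean_space \<Rightarrow> real) \<Rightarrow> ('a \<Rightarrow> real) \<Rightarrow> 'a \<Rightarrow> real" where
  "div_op c \<phi> x = - (\<Sum>k\<in>Basis. partial k (\<lambda>y. c y * partial k \<phi> y) x)"

text \<open>For \<open>\<Omega>\<close> open and nonempty, \<open>c\<close> positive and \<open>C\<^sup>1\<close> on \<open>\<Omega>\<close>, \<open>\<rho>\<close> positive and continuous on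
  \<open>\<Omega>\<close>, and \<open>p > 0\<close>, both integrands are continuous with compact support in \<open>\<Omega>\<close>, the denominator
  is positive, and the set of quotients is nonempty and bounded below by \<open>0\<close>; so the
  real-valued integrals and infimum are the intended ones.\<close>

definition rellich_const ::
    "real \<Rightarrow> 'a::euclidean_space set \<Rightarrow> ('a \<Rightarrow> real) \<Rightarrow> ('a \<Rightarrow> real) \<Rightarrow> real" where
  "rellich_const p \<Omega> c \<rho> =
     Inf {(LINT x:\<Omega>|lborel. \<bar>div_op c \<phi> x\<bar> powr p) /
          (LINT x:\<Omega>|lborel. c x powr p * \<rho> x powr (- 2 * p) * \<bar>\<phi> x\<bar> powr p)
          | \<phi>. \<phi> \<in> C2c \<Omega> \<and> \<phi> \<noteq> (\<lambda>x. 0)}"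

end

theory Submission
  imports Defs
begin

text \<open>
  Write \<open>D\<close> for the dimension, \<open>r = norm x\<close>, \<open>m = D - (2 - \<delta>) p\<close>, \<open>b = - (2 - \<delta>) p\<close> and
  \<open>\<kappa> = (p - 1) D m / p\<^sup>2\<close>. The weight in the denominator is \<open>r\<close> to the power \<open>b\<close>, and the claim is
  that the infimum is \<open>\<kappa>\<close> to the power \<open>p\<close>. The function \<open>r\<close> to the power \<open>- m / p\<close> is mapped by
  \<open>H\<close> to \<open>\<kappa>\<close> times the correct power of \<open>r\<close>, and for it both integrands are multiples of
  \<open>r\<close> to the power \<open>- D\<close>: it is the borderline function that would attain the infimum if its
  integrals converged.

  Lower bound. With \<open>a = (2 - \<delta>) (p - 1)\<close>, test \<open>H \<phi>\<close> against \<open>r\<close> to the power \<open>- a\<close> times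
  \<open>G \<phi>\<close>, where \<open>G t\<close> is \<open>t\<close> times \<open>\<bar>t\<bar>\<close> to the power \<open>p - 2\<close>. Integration by parts produces a term
  with \<open>G' \<phi>\<close> and the square of the radial derivative, from which completing a square extracts the
  Hardy constant, and a second integration by parts against the radial field \<open>x\<close> removes the
  remaining first-order term. Young's inequality then separates \<open>H \<phi>\<close> from \<open>G \<phi>\<close>. All this is
  carried out before integrating: for an explicit compactly supported vector field \<open>V\<close> the lemma
  \<open>pointwise_rellich_bound\<close> bounds the weighted power of \<open>\<phi>\<close> by \<open>div V\<close> plus a multiple of the
  power of \<open>H \<phi>\<close>, and \<open>integral_partial_eq_0\<close> says that \<open>div V\<close> integrates to zero. For
  \<open>p < 2\<close> the function \<open>G\<close> is not differentiable at \<open>0\<close>; replacing \<open>t\<^sup>2\<close> by \<open>t\<^sup>2 + \<epsilon>\<close> repairs this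
  and costs an error of order \<open>\<epsilon>\<close> to the power \<open>p / 2\<close>, which vanishes in \<open>rellich_inequality\<close>.

  Upper bound. Cut the borderline function off with a fixed profile in the variable \<open>ln r\<close>, so that
  it is unchanged for \<open>0 \<le> ln r \<le> n\<close> and vanishes outside \<open>- 1 \<le> ln r \<le> n + 1\<close>. On the plateau the
  two integrands have the exact ratio \<open>\<kappa>\<close> to the power \<open>p\<close>. Since \<open>r\<close> to the power \<open>- D\<close> has
  comparable mass on all shells \<open>k \<le> ln r \<le> k + 1\<close>, the plateau contributes at least a multiple of
  \<open>n\<close>, while the two transition shells contribute a bounded amount. Hence the quotients are at most
  the constant plus \<open>O(1 / n)\<close>; this is \<open>rellich_test_functions\<close>.
\<close>

section \<open>Partial derivatives along coordinate lines\<close>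

text \<open>The relational form composes with the rules for one-variable derivatives, which the value of
  \<open>partial\<close> alone does not: \<open>partial\<close> is an arbitrary number where the derivative fails to exist.\<close>

definition has_partial :: "('a::euclidean_space \<Rightarrow> real) \<Rightarrow> 'a \<Rightarrow> real \<Rightarrow> 'a \<Rightarrow> bool" where
  "has_partial f k D x \<longleftrightarrow> ((\<lambda>t. f (x + t *\<^sub>R k)) has_real_derivative D) (at 0)"

lemma partial_eqI: "has_partial f k D x \<Longrightarrow> partial k f x = D"
  unfolding partial_def has_partial_def by (rule DERIV_imp_deriv)

lemma has_partial_mult:
  assumes "has_partial f k D x" "has_partial g k E x"
  shows "has_partial (\<lambda>y. f y * g y) k (D * g x + f x * E) x"
  using DERIV_mult[OF assms[unfolded has_partial_def]] by (simp add: has_partial_def mult.commute)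

lemma has_partial_add:
  assumes "has_partial f k D x" "has_partial g k E x"
  shows "has_partial (\<lambda>y. f y + g y) k (D + E) x"
  using DERIV_add[OF assms[unfolded has_partial_def]] by (simp add: has_partial_def)

lemma has_partial_cmult:
  assumes "has_partial f k D x"
  shows "has_partial (\<lambda>y. c * f y) k (c * D) x"
  using DERIV_cmult[OF assms[unfolded has_partial_def]] by (simp add: has_partial_def)

lemma has_partial_chain:
  assumes "(h has_real_derivative E) (at (f x))" "has_partial f k D x"
  shows "has_partial (\<lambda>y. h (f y)) k (E * D) x"
  using DERIV_chain2[of h E "\<lambda>t. f (x + t *\<^sub>R k)" 0 D UNIV] assms by (simp add: has_partial_def)

lemma has_partial_if_has_derivative:
  assumes "(f has_derivative f') (at x)"
  shows "has_partial f k (f' k) x"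
proof -
  have "((\<lambda>t::real. x + t *\<^sub>R k) has_derivative (\<lambda>t. t *\<^sub>R k)) (at 0)"
    by (auto intro!: derivative_eq_intros)
  then have "((\<lambda>t. f (x + t *\<^sub>R k)) has_derivative (\<lambda>t. f' (t *\<^sub>R k))) (at 0)"
    using has_derivative_compose[of "\<lambda>t. x + t *\<^sub>R k" "\<lambda>t. t *\<^sub>R k" 0 UNIV f f'] assms by simp
  moreover have "f' (t *\<^sub>R k) = f' k * t" for t
    using has_derivative_bounded_linear[OF assms] by (simp add: bounded_linear.linear linear_cmul)
  ultimately show ?thesis
    by (simp add: has_partial_def has_field_derivative_def)
qed

lemma has_partial_differentiable:
  "f differentiable (at x) \<Longrightarrow> has_partial f k (partial k f x) x"
  using has_partial_if_has_derivative partial_eqI unfolding differentiable_def by metis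

lemma has_partial_transform:
  assumes "has_partial f k D x" "open U" "x \<in> U" "\<And>y. y \<in> U \<Longrightarrow> f y = g y"
  shows "has_partial g k D x"
proof -
  have "open ((\<lambda>t::real. x + t *\<^sub>R k) -` U)"
    using assms(2) by (intro open_vimage continuous_intros) 
  then show ?thesis
    using assms unfolding has_partial_def
    by (intro has_field_derivative_transform_within_open[OF assms(1)[unfolded has_partial_def]]) auto
qed

lemma has_partial_norm_powr:
  assumes "x \<noteq> 0"
  shows "has_partial (\<lambda>y. norm y powr e) k (e * norm x powr (e - 2) * (x \<bullet> k)) x"
proof -
  have n: "has_partial norm k (sgn x \<bullet> k) x"
    using has_partial_if_has_derivative[OF has_derivative_norm[OF assms]] by (simp add: inner_commute)
  have "((\<lambda>z. z powr e) has_real_derivative e * norm x powr (e - 1)) (at (norm x))"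
    using assms by (intro has_real_derivative_powr) auto
  then have "has_partial (\<lambda>y. norm y powr e) k (e * norm x powr (e - 1) * (sgn x \<bullet> k)) x"
    by (rule has_partial_chain[OF _ n])
  moreover have "norm x powr (e - 1) * (sgn x \<bullet> k) = norm x powr (e - 2) * (x \<bullet> k)"
    using assms powr_add[of "norm x" "e - 2" 1] by (simp add: sgn_div_norm powr_minus_divide)
  ultimately show ?thesis by (simp add: mult.assoc)
qed

lemma has_partial_inner:
  "k \<in> Basis \<Longrightarrow> has_partial (\<lambda>y. y \<bullet> k) k 1 x"
  unfolding has_partial_def by (auto intro!: derivative_eq_intros simp: inner_add_left)

lemma has_partial_along_line:
  assumes "has_partial f k D (x + t *\<^sub>R k)"
  shows "((\<lambda>u. f (x + u *\<^sub>R k)) has_real_derivative D) (at t)"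
  using DERIV_shift[of "\<lambda>u. f (x + u *\<^sub>R k)" D 0 t] assms
  by (simp add: has_partial_def algebra_simps)

section \<open>The integral of a compactly supported divergence\<close>

text \<open>By translation invariance every difference quotient of \<open>f\<close> in the direction \<open>k\<close> has integral
  zero. The mean value theorem bounds the quotients by the maximum of \<open>\<bar>g\<bar>\<close> on \<open>K\<close>, and they live on a
  fixed ball, so dominated convergence passes to the limit.\<close>

lemma integral_partial_eq_0:
  fixes f g :: "'a::euclidean_space \<Rightarrow> real"
  assumes K: "compact K" "K \<subseteq> S" and S: "open S" and f0: "\<And>x. x \<notin> K \<Longrightarrow> f x = 0"
    and fc: "continuous_on S f" and fg: "\<And>x. x \<in> S \<Longrightarrow> has_partial f k (g x) x"
    and gc: "continuous_on S g" and k: "norm k = 1"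
  shows "(LINT x|lborel. indicator K x * g x) = 0"
proof -
  define g' where "g' x = indicator K x * g x" for x
  have g': "has_partial f k (g' x) x" for x
  proof (cases "x \<in> K")
    case True then show ?thesis using K fg by (auto simp: g'_def)
  next
    case False
    have "has_partial (\<lambda>_. 0) k 0 x" by (simp add: has_partial_def)
    then have "has_partial f k 0 x"
      by (rule has_partial_transform[where U = "- K"]) (use K False f0 compact_imp_closed in auto)
    then show ?thesis using False by (simp add: g'_def)
  qed
  have "bounded (g ` K)"
    using compact_continuous_image[OF continuous_on_subset[OF gc K(2)] K(1)] by (rule compact_imp_bounded)
  then obtain B where B: "\<And>x. x \<in> K \<Longrightarrow> \<bar>g x\<bar> \<le> B"
    unfolding bounded_iff by auto
  define C where "C = max B 0"
  have C: "\<bar>g' x\<bar> \<le> C" for x using B[of x] by (auto simp: g'_def C_def indicator_def)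
  obtain R where R: "\<And>x. x \<in> K \<Longrightarrow> norm x \<le> R"
    using compact_imp_bounded[OF K(1)] unfolding bounded_iff by auto
  have cont: "continuous_on UNIV f"
  proof -
    have "continuous_on (- K) f" using f0 by (simp cong: continuous_on_cong_simp)
    then have "continuous_on (S \<union> - K) f"
      using fc S K compact_imp_closed by (intro continuous_on_open_Un) auto
    moreover have "S \<union> - K = UNIV" using K by auto
    ultimately show ?thesis by simp
  qed
  then have meas[measurable]: "f \<in> borel_measurable borel"
    by (rule borel_measurable_continuous_onI)
  have fi: "integrable lborel f"
  proof -
    have "integrable lborel (\<lambda>x. indicator K x *\<^sub>R f x)"
      using K continuous_on_subset[OF cont] by (intro borel_integrable_compact) auto
    moreover have "(\<lambda>x. indicator K x *\<^sub>R f x) = f"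
      by (rule ext) (use f0 in \<open>auto simp: indicator_def\<close>)
    ultimately show ?thesis by simp
  qed
  have tr: "integrable lborel (\<lambda>x. f (c + x))" "(LINT x|lborel. f (c + x)) = (LINT x|lborel. f x)" for c
  proof -
    have *: "distr lborel borel ((+) c) = lborel" by (rule lborel_distr_plus)
    show "(LINT x|lborel. f (c + x)) = (LINT x|lborel. f x)"
      by (subst (2) *[symmetric], subst integral_distr) auto
    have "integrable (distr lborel borel ((+) c)) f" using fi unfolding * .
    then show "integrable lborel (\<lambda>x. f (c + x))"
      by (subst (asm) integrable_distr_eq) auto
  qed
  define h where "h n = inverse (real (Suc n))" for n
  have h: "h n > 0" "h n \<le> 1" for n by (auto simp: h_def field_simps)
  define s where "s n x = (f (h n *\<^sub>R k + x) - f x) / h n" for n x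
  have "(\<lambda>n. LINT x|lborel. s n x) \<longlonglongrightarrow> (LINT x|lborel. g' x)"
  proof (rule integral_dominated_convergence)
    have lim: "(\<lambda>n. s n x) \<longlonglongrightarrow> g' x" for x
    proof -
      have "((\<lambda>t. (f (x + t *\<^sub>R k) - f x) / t) \<longlongrightarrow> g' x) (at 0)"
        using g'[of x] by (simp add: has_partial_def has_field_derivative_iff)
      moreover have "filterlim h (at 0) sequentially"
        using h LIMSEQ_inverse_real_of_nat unfolding filterlim_at h_def
        by (auto intro!: always_eventually)
      ultimately have "(\<lambda>n. (f (x + h n *\<^sub>R k) - f x) / h n) \<longlonglongrightarrow> g' x"
        by (rule filterlim_compose)
      then show ?thesis
        by (simp only: s_def add.commute[of x])
    qed
    then show "AE x in lborel. (\<lambda>n. s n x) \<longlonglongrightarrow> g' x" by simp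
    show m: "s n \<in> borel_measurable lborel" for n unfolding s_def by measurable
    show "g' \<in> borel_measurable lborel"
      by (rule borel_measurable_LIMSEQ_real[where u = s]) (use lim m in auto)
    show "integrable lborel (\<lambda>x. indicator (cball 0 (R + 1)) x * C)"
      using emeasure_bounded_finite[OF bounded_cball] by (auto intro!: integrable_real_indicator)
    show "AE x in lborel. norm (s n x) \<le> indicator (cball 0 (R + 1)) x * C" for n
    proof (rule AE_I2)
      fix x
      \<comment> \<open>The mean value theorem turns the difference quotient into a value of the derivative.\<close>
      obtain z where "0 < z" "z < h n" "f (x + h n *\<^sub>R k) - f (x + 0 *\<^sub>R k) = (h n - 0) * g' (x + z *\<^sub>R k)"
        using MVT2[of 0 "h n" "\<lambda>u. f (x + u *\<^sub>R k)" "\<lambda>u. g' (x + u *\<^sub>R k)"] h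
          has_partial_along_line[OF g'] by blast
      then have "s n x = g' (x + z *\<^sub>R k)" using h[of n] by (simp add: s_def add.commute)
      then have 1: "\<bar>s n x\<bar> \<le> C" using C by simp
      have "s n x = 0" if "x \<notin> cball 0 (R + 1)"
      proof -
        have "norm (h n *\<^sub>R k) \<le> 1" using h[of n] k by simp
        then have "norm x \<le> norm (h n *\<^sub>R k + x) + 1"
          using norm_triangle_ineq4[of "h n *\<^sub>R k + x" "h n *\<^sub>R k"] by simp
        then have "h n *\<^sub>R k + x \<notin> K" "x \<notin> K" using that R[of x] R[of "h n *\<^sub>R k + x"] by auto
        then show ?thesis using f0 by (simp add: s_def)
      qed
      then show "norm (s n x) \<le> indicator (cball 0 (R + 1)) x * C"
        using 1 by (auto simp: indicator_def)
    qed
  qed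
  moreover have "(LINT x|lborel. s n x) = 0" for n
    unfolding s_def using tr[of "h n *\<^sub>R k"] fi by simp
  ultimately show ?thesis by (simp add: LIMSEQ_const_iff g'_def)
qed

section \<open>The pointwise inequality behind the lower bound\<close>

text \<open>A smooth substitute for \<open>\<bar>t\<bar>\<close> to the power \<open>p\<close>. Subtracting the constant makes it vanish at
  \<open>0\<close>, so that composing it with a compactly supported function keeps the support compact.\<close>

definition reg_power :: "real \<Rightarrow> real \<Rightarrow> real \<Rightarrow> real" where
  "reg_power p \<epsilon> t = (t\<^sup>2 + \<epsilon>) powr (p/2) - \<epsilon> powr (p/2)"

definition reg_dual :: "real \<Rightarrow> real \<Rightarrow> real \<Rightarrow> real" where
  "reg_dual p \<epsilon> t = t * (t\<^sup>2 + \<epsilon>) powr (p/2 - 1)"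

definition reg_dual' :: "real \<Rightarrow> real \<Rightarrow> real \<Rightarrow> real" where
  "reg_dual' p \<epsilon> t = (t\<^sup>2 + \<epsilon>) powr (p/2 - 2) * ((p - 1) * t\<^sup>2 + \<epsilon>)"

lemma DERIV_reg_power:
  assumes "\<epsilon> > 0"
  shows "(reg_power p \<epsilon> has_real_derivative p * reg_dual p \<epsilon> t) (at t)"
proof -
  have [simp]: "t\<^sup>2 + \<epsilon> > 0" using assms by (simp add: add_nonneg_pos)
  show ?thesis unfolding reg_power_def[abs_def] reg_dual_def
    by (auto intro!: derivative_eq_intros)
qed

lemma DERIV_reg_dual:
  assumes "\<epsilon> > 0"
  shows "(reg_dual p \<epsilon> has_real_derivative reg_dual' p \<epsilon> t) (at t)"
proof -
  have [simp]: "t\<^sup>2 + \<epsilon> > 0" using assms by (simp add: add_nonneg_pos)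
  have "(t\<^sup>2 + \<epsilon>) powr (p/2 - 1) = (t\<^sup>2 + \<epsilon>) powr (p/2 - 2) * (t\<^sup>2 + \<epsilon>)"
    using powr_add[of "t\<^sup>2 + \<epsilon>" "p/2 - 2" 1] by (simp add: abs_of_pos)
  then have e: "(t\<^sup>2 + \<epsilon>) powr (p/2 - 1) + t * ((p/2 - 1) * (t\<^sup>2 + \<epsilon>) powr (p/2 - 2) * (2 * t)) = reg_dual' p \<epsilon> t"
    unfolding reg_dual'_def by (simp add: algebra_simps power2_eq_square)
  show ?thesis unfolding reg_dual_def[abs_def] e[symmetric]
    by (auto intro!: derivative_eq_intros simp: diff_diff_eq)
qed

lemma abs_powr_le_reg_base:
  fixes t \<epsilon> p :: real
  assumes "\<epsilon> > 0" "p > 0"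
  shows "\<bar>t\<bar> powr p \<le> (t\<^sup>2 + \<epsilon>) powr (p/2)"
proof -
  have "\<bar>t\<bar> powr p = (t\<^sup>2) powr (p/2)"
    using powr_powr[of "\<bar>t\<bar>" 2 "p/2"] by (cases "t = 0") auto
  also have "\<dots> \<le> (t\<^sup>2 + \<epsilon>) powr (p/2)" using assms by (intro powr_mono2) auto
  finally show ?thesis .
qed

lemma reg_dual_powr_le:
  assumes "\<epsilon> > 0" "p > 1"
  shows "\<bar>reg_dual p \<epsilon> t\<bar> powr (p / (p - 1)) \<le> (t\<^sup>2 + \<epsilon>) powr (p/2)"
proof -
  define z where "z = t\<^sup>2 + \<epsilon>"
  have z: "z > 0" using assms by (simp add: z_def add_nonneg_pos)
  have "\<bar>t\<bar> \<le> z powr (1/2)"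
    using assms abs_powr_le_reg_base[of \<epsilon> 1 t] by (simp add: z_def)
  then have "\<bar>reg_dual p \<epsilon> t\<bar> \<le> z powr (1/2) * z powr (p/2 - 1)"
    by (simp add: reg_dual_def abs_mult z_def mult_right_mono)
  also have "\<dots> = z powr ((p - 1) / 2)" by (simp add: powr_add[symmetric] diff_divide_distrib)
  finally have "\<bar>reg_dual p \<epsilon> t\<bar> powr (p / (p - 1)) \<le> (z powr ((p - 1) / 2)) powr (p / (p - 1))"
    using assms by (intro powr_mono2) auto
  also have "\<dots> = z powr (p/2)"
  proof -
    have "(p - 1) / 2 * (p / (p - 1)) = p / 2" using assms by (simp add: field_simps)
    then show ?thesis by (simp only: powr_powr)
  qed
  finally show ?thesis by (simp add: z_def)
qed

text \<open>Without regularisation this is an equality, because then \<open>G' t\<close> is \<open>p - 1\<close> times \<open>\<bar>t\<bar>\<close> to the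
  power \<open>p - 2\<close>. It remains true for all \<open>\<epsilon>\<close> with the sharp factor \<open>p - 1\<close> since the
  extra summand \<open>\<epsilon>\<close> of \<open>G'\<close> has the favourable sign.\<close>

lemma reg_dual_square_le:
  assumes "\<epsilon> > 0" "p > 1"
  shows "(p - 1) * (reg_dual p \<epsilon> t)\<^sup>2 \<le> reg_dual' p \<epsilon> t * (t\<^sup>2 + \<epsilon>) powr (p/2)"
proof -
  define z where "z = t\<^sup>2 + \<epsilon>"
  have z: "z > 0" using assms by (simp add: z_def add_nonneg_pos)
  have e: "(z powr (p/2 - 1))\<^sup>2 = z powr (p/2 - 2) * z powr (p/2)"
    by (simp add: power2_eq_square powr_add[symmetric])
  have "(p - 1) * (reg_dual p \<epsilon> t)\<^sup>2 = ((p - 1) * t\<^sup>2) * (z powr (p/2 - 2) * z powr (p/2))"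
    by (simp add: reg_dual_def power_mult_distrib z_def[symmetric] e)
  also have "\<dots> \<le> ((p - 1) * t\<^sup>2 + \<epsilon>) * (z powr (p/2 - 2) * z powr (p/2))"
    using assms by (intro mult_right_mono) auto
  finally show ?thesis by (simp add: reg_dual'_def z_def mult_ac)
qed

lemma reg_dual'_pos:
  assumes "\<epsilon> > 0" "p > 1"
  shows "reg_dual' p \<epsilon> t > 0"
proof -
  have "t\<^sup>2 + \<epsilon> > 0" "(p - 1) * t\<^sup>2 + \<epsilon> > 0" using assms by (auto intro!: add_nonneg_pos)
  then show ?thesis by (simp add: reg_dual'_def)
qed

text \<open>The weights are the ones for which equality holds at \<open>X = K t\<close> and \<open>Y\<close> equal to the power
  \<open>p - 1\<close> of \<open>t\<close>, the relation between \<open>\<bar>H \<phi>\<bar>\<close> and \<open>\<bar>\<phi>\<bar>\<close> for the borderline function.\<close>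

lemma young_weighted:
  fixes X Y K p :: real
  assumes "p > 1" "K > 0" "X \<ge> 0" "Y \<ge> 0"
  shows "X * Y \<le> K powr (1 - p) / p * X powr p + (p - 1) / p * K * Y powr (p / (p - 1))"
proof -
  define k where "k = K powr ((p - 1) / p)"
  have k: "k > 0" using assms by (simp add: k_def)
  have "X * Y = (X / k) * (Y * k)" using k by simp
  also have "\<dots> \<le> (X / k) powr p / p + (Y * k) powr (p / (p - 1)) / (p / (p - 1))"
    using assms k by (intro Youngs_inequality) (auto simp: field_simps)
  also have "(X / k) powr p = K powr (1 - p) * X powr p"
    using assms k by (simp add: powr_divide k_def powr_powr powr_minus_divide[of K "p - 1", simplified])
  also have "(Y * k) powr (p / (p - 1)) = K * Y powr (p / (p - 1))"
    using assms k by (simp add: powr_mult k_def powr_powr)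
  finally show ?thesis using assms by (simp add: field_simps)
qed

text \<open>Completing the square in \<open>u\<close>. Applied with \<open>u = x \<bullet> \<nabla>\<phi>\<close>, this replaces Hardy's inequality;
  \<open>s = m / p\<close> is the decay exponent of the borderline function, for which \<open>u = - s \<phi>\<close>.\<close>

lemma quadratic_form_lower_bound:
  fixes g g' P p s u :: real
  assumes "g' > 0" "p > 1" "(p - 1) * g\<^sup>2 \<le> g' * P"
  shows "g' * u\<^sup>2 + 2 * s * (p - 1) * g * u \<ge> - (s\<^sup>2 * (p - 1) * P)"
proof -
  have "0 \<le> (g' * u + s * (p - 1) * g)\<^sup>2" by simp
  also have "\<dots> = g' * (g' * u\<^sup>2 + 2 * s * (p - 1) * g * u) + s\<^sup>2 * (p - 1) * ((p - 1) * g\<^sup>2)"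
    by (simp add: power2_eq_square algebra_simps)
  also have "\<dots> \<le> g' * (g' * u\<^sup>2 + 2 * s * (p - 1) * g * u) + s\<^sup>2 * (p - 1) * (g' * P)"
    using assms by (intro add_left_mono mult_left_mono) auto
  also have "\<dots> = g' * (g' * u\<^sup>2 + 2 * s * (p - 1) * g * u + s\<^sup>2 * (p - 1) * P)"
    by (simp add: algebra_simps)
  finally show ?thesis using assms(1) by (simp add: zero_le_mult_iff)
qed

text \<open>The bracket on the right is the divergence of the field \<open>V\<close> of the lower bound, written in
  terms of \<open>t = \<phi> x\<close>, \<open>u = x \<bullet> \<nabla>\<phi>\<close>, \<open>q = \<bar>\<nabla>\<phi>\<bar>\<^sup>2\<close> and \<open>h = H \<phi> x\<close>. The factor \<open>s'\<close> is chosen such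
  that the total coefficient of \<open>G u\<close> becomes \<open>2 (m / p) (p - 1)\<close>, the one that completing the
  square requires; the coefficient of \<open>\<bar>t\<bar>\<close> to the power \<open>p\<close> that is left over is then exactly \<open>K\<close>.
  Young's inequality consumes the fraction \<open>(p - 1) / p\<close> of it.\<close>

lemma pointwise_rellich_bound:
  fixes p \<epsilon> t u q h r a b m K s' :: real
  assumes p: "p > 1" and e: "\<epsilon> > 0" and r: "r > 0" and uq: "u\<^sup>2 \<le> r\<^sup>2 * q"
    and m: "m > 0" and a: "a \<ge> 0" and ab: "a * p = - b * (p - 1)"
    and K: "K = (p - 1) * m\<^sup>2 / p\<^sup>2 + a * m / p"
    and s': "s' = (a + 2 * (m / p) * (p - 1)) / p"
  shows "K / p * (r powr b * \<bar>t\<bar> powr p) \<le>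
    (- (r powr (- a) * reg_dual p \<epsilon> t * h) - a * r powr b * reg_dual p \<epsilon> t * u
       + r powr (b + 2) * reg_dual' p \<epsilon> t * q
       + s' * (m * r powr b * reg_power p \<epsilon> t + p * r powr b * reg_dual p \<epsilon> t * u))
    + K powr (1 - p) / p * \<bar>h\<bar> powr p + s' * m * \<epsilon> powr (p/2) * r powr b"
proof -
  define G G' P w where "G = reg_dual p \<epsilon> t" and "G' = reg_dual' p \<epsilon> t"
    and "P = (t\<^sup>2 + \<epsilon>) powr (p/2)" and "w = r powr b"
  have K0: "K > 0" using p m a unfolding K by (intro add_pos_nonneg) auto
  have w: "w > 0" using r by (simp add: w_def)
  have G': "G' > 0" using reg_dual'_pos[OF e p] by (simp add: G'_def)
  have rb: "r powr (b + 2) = w * r\<^sup>2" using r by (simp add: w_def powr_add)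
  have wa: "(r powr (- a)) powr (p / (p - 1)) = w"
  proof -
    have "- a * (p / (p - 1)) = b" using p ab by (simp add: field_simps)
    then show ?thesis by (simp only: powr_powr w_def)
  qed
  \<comment> \<open>The exponent \<open>a\<close> makes the conjugate power of \<open>r powr (- a)\<close> equal to the weight.\<close>
  have "r powr (- a) * G * h \<le> \<bar>h\<bar> * (r powr (- a) * \<bar>G\<bar>)"
    using abs_ge_self[of "r powr (- a) * G * h"] by (simp add: abs_mult mult_ac)
  also have "\<dots> \<le> K powr (1 - p) / p * \<bar>h\<bar> powr p + (p - 1) / p * K * (r powr (- a) * \<bar>G\<bar>) powr (p / (p - 1))"
    using p K0 by (intro young_weighted) auto
  also have "(r powr (- a) * \<bar>G\<bar>) powr (p / (p - 1)) = w * \<bar>G\<bar> powr (p / (p - 1))"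
    using wa by (simp add: powr_mult)
  also have "(p - 1) / p * K * (w * \<bar>G\<bar> powr (p / (p - 1))) \<le> (p - 1) / p * K * (w * P)"
    using reg_dual_powr_le[OF e p, of t] p K0 w unfolding G_def P_def
    by (intro mult_left_mono) auto
  finally have 1: "r powr (- a) * G * h \<le> K powr (1 - p) / p * \<bar>h\<bar> powr p + (p - 1) / p * K * (w * P)"
    by simp
  \<comment> \<open>Only the radial part of the gradient is kept.\<close>
  have "w * (G' * u\<^sup>2) \<le> w * (G' * (r\<^sup>2 * q))"
    using uq w G' by (intro mult_left_mono) auto
  then have 2: "w * (G' * u\<^sup>2) \<le> r powr (b + 2) * G' * q" by (simp add: rb mult_ac)
  have "w * (G' * u\<^sup>2 + 2 * (m / p) * (p - 1) * G * u) \<ge> w * (- ((m / p)\<^sup>2 * (p - 1) * P))"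
    using quadratic_form_lower_bound[OF G' p, of G P "m / p" u] reg_dual_square_le[OF e p, of t] w
    unfolding G_def G'_def P_def by (intro mult_left_mono) auto
  then have 3: "w * (G' * u\<^sup>2) + w * (2 * (m / p) * (p - 1)) * (G * u) \<ge> - (w * ((m / p)\<^sup>2 * (p - 1)) * P)"
    by (simp add: algebra_simps)
  \<comment> \<open>The two identities that determine \<open>s'\<close> and \<open>K\<close>.\<close>
  have c1: "- (a * w * G * u) + s' * (p * w * G * u) = w * (2 * (m / p) * (p - 1)) * (G * u)"
    using p unfolding s' by (simp add: field_simps)
  have c2: "s' * m - (m / p)\<^sup>2 * (p - 1) = K"
    using p unfolding s' K by (simp add: field_simps power2_eq_square)
  have 4: "K / p * (w * \<bar>t\<bar> powr p) \<le> K / p * (w * P)"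
    using abs_powr_le_reg_base[OF e, of p t] p K0 w unfolding P_def by (intro mult_left_mono) auto
  have F: "reg_power p \<epsilon> t = P - \<epsilon> powr (p/2)" by (simp add: reg_power_def P_def)
  have c3: "s' * (m * w * (P - \<epsilon> powr (p/2))) + s' * m * \<epsilon> powr (p/2) * w = s' * m * (w * P)"
    by (simp add: algebra_simps)
  have c4: "s' * m * (w * P) - w * ((m / p)\<^sup>2 * (p - 1)) * P = K * (w * P)"
    unfolding c2[symmetric] by (simp add: algebra_simps)
  have c5: "K * (w * P) - (p - 1) / p * K * (w * P) = K / p * (w * P)"
    using p by (simp add: field_simps)
  show ?thesis
    unfolding F G_def[symmetric] G'_def[symmetric] w_def[symmetric]
    using 1 2 3 4 c1 c3 c4 c5 unfolding distrib_left[of s'] by linarith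
qed

section \<open>Test functions and the flux of their gradients\<close>

lemma C2c_facts:
  fixes \<phi> :: "'a::euclidean_space \<Rightarrow> real"
  assumes \<phi>: "\<phi> \<in> C2c S" and S: "open S"
  defines "K \<equiv> closure {x. \<phi> x \<noteq> 0}"
  shows "compact K" "K \<subseteq> S" "\<And>x. x \<notin> K \<Longrightarrow> \<phi> x = 0" "continuous_on S \<phi>"
    "\<And>x k. x \<in> S \<Longrightarrow> k \<in> Basis \<Longrightarrow> has_partial \<phi> k (partial k \<phi> x) x"
    "\<And>k. k \<in> Basis \<Longrightarrow> continuous_on S (partial k \<phi>)"
    "\<And>x k. x \<notin> K \<Longrightarrow> partial k \<phi> x = 0"
    "\<And>x k. x \<in> S \<Longrightarrow> k \<in> Basis \<Longrightarrow> has_partial (partial k \<phi>) k (partial k (partial k \<phi>) x) x"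
    "\<And>k. k \<in> Basis \<Longrightarrow> continuous_on S (partial k (partial k \<phi>))"
proof -
  show K: "compact K" "K \<subseteq> S" using \<phi> by (auto simp: C2c_def K_def)
  show 0: "\<phi> x = 0" if "x \<notin> K" for x
    using that closure_subset[of "{x. \<phi> x \<noteq> 0}"] by (auto simp: K_def)
  have C2: "C2_on S \<phi>" using \<phi> by (simp add: C2c_def)
  then have C1: "C1_on S \<phi>" by (simp add: C2_on_def)
  show "continuous_on S \<phi>"
    using C1 by (auto simp: C1_on_def intro!: continuous_at_imp_continuous_on differentiable_imp_continuous_within)
  show "has_partial \<phi> k (partial k \<phi> x) x" if "x \<in> S" for x k
    using C1 that by (auto simp: C1_on_def intro: has_partial_differentiable)
  show "continuous_on S (partial k \<phi>)" if "k \<in> Basis" for k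
    using C1 that by (auto simp: C1_on_def)
  show "partial k \<phi> x = 0" if "x \<notin> K" for x k
  proof -
    have "has_partial (\<lambda>_. 0) k 0 x" by (simp add: has_partial_def)
    then have "has_partial \<phi> k 0 x"
      by (rule has_partial_transform[where U = "- K"]) (use K that 0 compact_imp_closed in auto)
    then show ?thesis by (rule partial_eqI)
  qed
  show "has_partial (partial k \<phi>) k (partial k (partial k \<phi>) x) x" if "x \<in> S" "k \<in> Basis" for x k
    using C2 that by (auto simp: C2_on_def C1_on_def intro: has_partial_differentiable)
  show "continuous_on S (partial k (partial k \<phi>))" if "k \<in> Basis" for k
    using C2 that by (auto simp: C2_on_def C1_on_def)
qed

text \<open>The \<open>k\<close>-th summand of the divergence of \<open>c \<nabla>\<phi>\<close> for \<open>c = r\<close> to the power \<open>\<delta>\<close>, expanded by the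
  product rule; in this form it is visibly continuous away from the origin.\<close>

definition flux_partial :: "real \<Rightarrow> ('a::euclidean_space \<Rightarrow> real) \<Rightarrow> 'a \<Rightarrow> 'a \<Rightarrow> real" where
  "flux_partial \<delta> \<phi> k x = \<delta> * norm x powr (\<delta> - 2) * (x \<bullet> k) * partial k \<phi> x
     + norm x powr \<delta> * partial k (partial k \<phi>) x"

lemma has_partial_flux:
  assumes "\<phi> \<in> C2c (UNIV - {0})" "x \<noteq> 0" "k \<in> Basis"
  shows "has_partial (\<lambda>y. norm y powr \<delta> * partial k \<phi> y) k (flux_partial \<delta> \<phi> k x) x"
  unfolding flux_partial_def
  using assms by (intro has_partial_mult has_partial_norm_powr C2c_facts(8)[OF assms(1)]) auto

lemma div_op_eq_flux_partial:
  assumes "\<phi> \<in> C2c (UNIV - {0})" "x \<noteq> 0"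
  shows "div_op (\<lambda>x. norm x powr \<delta>) \<phi> x = - (\<Sum>k\<in>Basis. flux_partial \<delta> \<phi> k x)"
  unfolding div_op_def using partial_eqI[OF has_partial_flux[OF assms]] by simp

lemma continuous_flux_partial:
  assumes "\<phi> \<in> C2c (UNIV - {0})" "k \<in> Basis"
  shows "continuous_on (UNIV - {0}) (flux_partial \<delta> \<phi> k)"
  unfolding flux_partial_def[abs_def]
  using assms by (intro continuous_intros C2c_facts(6,9)[OF assms(1)]) auto

lemma div_op_outside_support:
  assumes "\<phi> \<in> C2c (UNIV - {0})" "x \<notin> closure {x. \<phi> x \<noteq> 0}"
  shows "div_op (\<lambda>x. norm x powr \<delta>) \<phi> x = 0"
proof -
  note C = C2c_facts[OF assms(1) open_delete[OF open_UNIV]]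
  have "partial k (\<lambda>y. norm y powr \<delta> * partial k \<phi> y) x = 0" for k
  proof -
    have "has_partial (\<lambda>_. 0) k 0 x" by (simp add: has_partial_def)
    then have "has_partial (\<lambda>y. norm y powr \<delta> * partial k \<phi> y) k 0 x"
      by (rule has_partial_transform[where U = "- closure {x. \<phi> x \<noteq> 0}"]) (use C(7) assms(2) in auto)
    then show ?thesis by (rule partial_eqI)
  qed
  then show ?thesis by (simp add: div_op_def)
qed

lemma set_integral_eq_on_support:
  fixes f :: "'a::euclidean_space \<Rightarrow> real"
  assumes "K \<subseteq> S" "\<And>x. x \<notin> K \<Longrightarrow> f x = 0"
  shows "(LINT x:S|lborel. f x) = (LINT x|lborel. indicator K x * f x)"
  unfolding set_lebesgue_integral_def
  by (rule arg_cong[where f = "integral\<^sup>L lborel"], rule ext) (use assms in \<open>auto simp: indicator_def\<close>)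

section \<open>The weighted Rellich inequality\<close>

text \<open>The \<open>k\<close>-th component of the field is \<open>V k\<close>. Its partial derivatives sum to the bracket of
  \<open>pointwise_rellich_bound\<close> and integrate to zero, since \<open>V\<close> vanishes wherever \<open>\<phi>\<close> does.\<close>

lemma rellich_inequality_regularised:
  fixes \<phi> :: "'a::euclidean_space \<Rightarrow> real"
  assumes \<phi>: "\<phi> \<in> C2c (UNIV - {0})" and p: "p > 1" and \<delta>: "\<delta> \<le> 2"
    and m: "m = real DIM('a) - (2 - \<delta>) * p" "m > 0"
    and \<kappa>: "\<kappa> = (p - 1) * real DIM('a) * m / p\<^sup>2"
    and \<epsilon>: "\<epsilon> > 0"
  defines "S \<equiv> closure {x. \<phi> x \<noteq> 0}"
  defines "b \<equiv> - ((2 - \<delta>) * p)"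
  defines "C \<equiv> (((2 - \<delta>) * (p - 1) + 2 * (m / p) * (p - 1)) / p) * m"
  shows "\<kappa> / p * (LINT x|lborel. indicator S x * (norm x powr b * \<bar>\<phi> x\<bar> powr p))
     \<le> \<kappa> powr (1 - p) / p * (LINT x|lborel. indicator S x * \<bar>div_op (\<lambda>x. norm x powr \<delta>) \<phi> x\<bar> powr p)
       + C * \<epsilon> powr (p/2) * (LINT x|lborel. indicator S x * norm x powr b)"
proof -
  let ?\<Omega> = "UNIV - {0::'a}"
  have op: "open ?\<Omega>" by auto
  note C2 = C2c_facts[OF \<phi> op, folded S_def]
  have nz: "x \<noteq> 0" if "x \<in> S" for x using C2(2) that by auto
  define a where "a = (2 - \<delta>) * (p - 1)"
  define s' where "s' = (a + 2 * (m / p) * (p - 1)) / p"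
  have a: "a \<ge> 0" using p \<delta> by (simp add: a_def)
  have ab: "a * p = - b * (p - 1)" by (simp add: a_def b_def)
  have b: "b = \<delta> - a - 2" by (simp add: a_def b_def algebra_simps)
  have bm: "b + real DIM('a) = m" by (simp add: b_def m(1))
  have \<kappa>': "\<kappa> = (p - 1) * m\<^sup>2 / p\<^sup>2 + a * m / p"
  proof -
    have "(p - 1) * m\<^sup>2 + a * m * p = (p - 1) * real DIM('a) * m"
      unfolding a_def m(1) power2_eq_square by (simp add: algebra_simps)
    moreover have "a * m / p = a * m * p / p\<^sup>2" using p by (simp add: power2_eq_square)
    ultimately show ?thesis unfolding \<kappa> by (simp add: add_divide_distrib[symmetric])
  qed
  define h where "h = div_op (\<lambda>x. norm x powr \<delta>) \<phi>"
  have h: "h x = - (\<Sum>k\<in>Basis. flux_partial \<delta> \<phi> k x)" if "x \<noteq> 0" for x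
    unfolding h_def using div_op_eq_flux_partial[OF \<phi> that] .
  define V where "V k y = (norm y powr (- a) * reg_dual p \<epsilon> (\<phi> y)) * (norm y powr \<delta> * partial k \<phi> y)
      + s' * ((norm y powr b * reg_power p \<epsilon> (\<phi> y)) * (y \<bullet> k))" for k y
  define DV where "DV k x = ((- a * norm x powr (- a - 2) * (x \<bullet> k)) * reg_dual p \<epsilon> (\<phi> x)
        + norm x powr (- a) * (reg_dual' p \<epsilon> (\<phi> x) * partial k \<phi> x)) * (norm x powr \<delta> * partial k \<phi> x)
      + (norm x powr (- a) * reg_dual p \<epsilon> (\<phi> x)) * flux_partial \<delta> \<phi> k x
      + s' * (((b * norm x powr (b - 2) * (x \<bullet> k)) * reg_power p \<epsilon> (\<phi> x)
        + norm x powr b * ((p * reg_dual p \<epsilon> (\<phi> x)) * partial k \<phi> x)) * (x \<bullet> k)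
        + (norm x powr b * reg_power p \<epsilon> (\<phi> x)) * 1)" for k x
  have pV: "has_partial (V k) k (DV k x) x" if "x \<in> ?\<Omega>" "k \<in> Basis" for k x
    unfolding V_def[abs_def] DV_def using that
    by (intro has_partial_add has_partial_mult has_partial_cmult has_partial_norm_powr
        has_partial_chain[OF DERIV_reg_dual[OF \<epsilon>]] has_partial_chain[OF DERIV_reg_power[OF \<epsilon>]]
        C2(5) has_partial_flux[OF \<phi>] has_partial_inner) auto
  have pos: "t\<^sup>2 + \<epsilon> \<noteq> 0" for t :: real
    using \<epsilon> add_nonneg_pos[of "t\<^sup>2" \<epsilon>] by simp
  have cont: "continuous_on ?\<Omega> (\<lambda>x. norm x powr e)" for e
    by (intro continuous_intros) auto
  have creg: "continuous_on ?\<Omega> (\<lambda>x. reg_power p \<epsilon> (\<phi> x))" "continuous_on ?\<Omega> (\<lambda>x. reg_dual p \<epsilon> (\<phi> x))"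
    "continuous_on ?\<Omega> (\<lambda>x. reg_dual' p \<epsilon> (\<phi> x))"
    unfolding reg_power_def reg_dual_def reg_dual'_def
    by (intro continuous_intros C2(4); simp add: pos)+
  note ci = continuous_on_add continuous_on_mult continuous_on_const continuous_on_inner continuous_on_id
  have cV: "continuous_on ?\<Omega> (V k)" if "k \<in> Basis" for k
    unfolding V_def[abs_def] by (intro ci cont creg C2(6) that)
  have cDV: "continuous_on ?\<Omega> (DV k)" if "k \<in> Basis" for k
    unfolding DV_def[abs_def] by (intro ci cont creg C2(6) continuous_flux_partial[OF \<phi>] that)
  have ch: "continuous_on ?\<Omega> h"
  proof -
    have "continuous_on ?\<Omega> (\<lambda>x. - (\<Sum>k\<in>Basis. flux_partial \<delta> \<phi> k x))"
      by (intro continuous_intros continuous_flux_partial[OF \<phi>])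
    then show ?thesis by (rule continuous_on_eq) (use h in auto)
  qed
  have V0: "V k x = 0" if "x \<notin> S" for k x
    using C2(3)[OF that] \<epsilon> by (simp add: V_def reg_dual_def reg_power_def)
  have intV: "(LINT x|lborel. indicator S x * DV k x) = 0" if "k \<in> Basis" for k
    by (rule integral_partial_eq_0[where f = "V k" and S = ?\<Omega> and k = k])
      (use C2 V0 pV cV cDV that in auto)
  have int: "integrable lborel (\<lambda>x. indicator S x * f x)" if "continuous_on ?\<Omega> f" for f :: "'a \<Rightarrow> real"
    using borel_integrable_compact[OF C2(1) continuous_on_subset[OF that C2(2)]] by simp
  have sumsq: "(\<Sum>k\<in>Basis. (x \<bullet> k)\<^sup>2) = (norm x)\<^sup>2" for x :: 'a
    unfolding power2_norm_eq_inner euclidean_inner[of x x] by (simp only: power2_eq_square)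
  \<comment> \<open>The divergence of \<open>V\<close>, where the divergence of \<open>x\<close> supplies the dimension in \<open>m\<close>.\<close>
  have sumDV: "(\<Sum>k\<in>Basis. DV k x) = (- (norm x powr (- a) * reg_dual p \<epsilon> (\<phi> x) * h x)
       - a * norm x powr b * reg_dual p \<epsilon> (\<phi> x) * (\<Sum>k\<in>Basis. (x \<bullet> k) * partial k \<phi> x)
       + norm x powr (b + 2) * reg_dual' p \<epsilon> (\<phi> x) * (\<Sum>k\<in>Basis. (partial k \<phi> x)\<^sup>2)
       + s' * (m * norm x powr b * reg_power p \<epsilon> (\<phi> x)
         + p * norm x powr b * reg_dual p \<epsilon> (\<phi> x) * (\<Sum>k\<in>Basis. (x \<bullet> k) * partial k \<phi> x)))"
    if x: "x \<noteq> 0" for x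
  proof -
    define G G' F where "G = reg_dual p \<epsilon> (\<phi> x)" and "G' = reg_dual' p \<epsilon> (\<phi> x)" and "F = reg_power p \<epsilon> (\<phi> x)"
    define u where "u k = (x \<bullet> k) * partial k \<phi> x" for k
    have e1: "norm x powr (- a - 2) * norm x powr \<delta> = norm x powr b"
      "norm x powr (- a) * norm x powr \<delta> = norm x powr (b + 2)"
      by (simp_all add: powr_add[symmetric] b algebra_simps)
    have e2: "norm x powr (b - 2) * (norm x)\<^sup>2 = norm x powr b"
      using x powr_add[of "norm x" "b - 2" 2] by simp
    have "DV k x = (s' * p - a) * norm x powr b * G * u k
        + norm x powr (b + 2) * G' * (partial k \<phi> x)\<^sup>2
        + norm x powr (- a) * G * flux_partial \<delta> \<phi> k x
        + s' * b * norm x powr (b - 2) * F * (x \<bullet> k)\<^sup>2 + s' * norm x powr b * F" for k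
      unfolding DV_def G_def[symmetric] G'_def[symmetric] F_def[symmetric] e1[symmetric] u_def
      by (simp add: algebra_simps power2_eq_square)
    then have "(\<Sum>k\<in>Basis. DV k x) = (s' * p - a) * norm x powr b * G * (\<Sum>k\<in>Basis. u k)
        + norm x powr (b + 2) * G' * (\<Sum>k\<in>Basis. (partial k \<phi> x)\<^sup>2)
        + norm x powr (- a) * G * (\<Sum>k\<in>Basis. flux_partial \<delta> \<phi> k x)
        + s' * b * norm x powr (b - 2) * F * (\<Sum>k\<in>Basis. (x \<bullet> k)\<^sup>2) + s' * norm x powr b * (real DIM('a) * F)"
      by (simp only: sum.distrib sum_distrib_left[symmetric] sum_constant of_nat_mult)
    also have "(\<Sum>k\<in>Basis. flux_partial \<delta> \<phi> k x) = - h x" using h[OF x] by simp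
    also have "(\<Sum>k\<in>Basis. (x \<bullet> k)\<^sup>2) = (norm x)\<^sup>2"
      by (rule sumsq)
    also have "s' * b * norm x powr (b - 2) * F * (norm x)\<^sup>2 = s' * b * F * norm x powr b"
      unfolding e2[symmetric] by (simp add: mult_ac)
    finally show ?thesis
      unfolding G_def[symmetric] G'_def[symmetric] F_def[symmetric] u_def[symmetric] bm[symmetric]
      by (simp add: algebra_simps)
  qed
  have uq: "(\<Sum>k\<in>Basis. (x \<bullet> k) * partial k \<phi> x)\<^sup>2 \<le> (norm x)\<^sup>2 * (\<Sum>k\<in>Basis. (partial k \<phi> x)\<^sup>2)" for x
    using Cauchy_Schwarz_ineq_sum[of "\<lambda>k. x \<bullet> k" "\<lambda>k. partial k \<phi> x" Basis]
    by (simp add: sumsq)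
  have pw: "\<kappa> / p * (indicator S x * (norm x powr b * \<bar>\<phi> x\<bar> powr p))
      \<le> (\<Sum>k\<in>Basis. indicator S x * DV k x) + \<kappa> powr (1 - p) / p * (indicator S x * \<bar>h x\<bar> powr p)
        + C * \<epsilon> powr (p/2) * (indicator S x * norm x powr b)" for x
  proof (cases "x \<in> S")
    case True
    then have x: "x \<noteq> 0" by (rule nz)
    then have "norm x > 0" by simp
    note pointwise_rellich_bound[OF p \<epsilon> this uq m(2) a ab \<kappa>' s'_def, of "\<phi> x" "h x", folded sumDV[OF x]]
    then show ?thesis using True by (simp add: C_def s'_def a_def)
  qed simp
  have i1: "integrable lborel (\<lambda>x. indicator S x * (norm x powr b * \<bar>\<phi> x\<bar> powr p))"
    using p by (intro int ci cont continuous_on_powr' continuous_on_rabs C2(4)) auto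
  have i2: "integrable lborel (\<lambda>x. indicator S x * \<bar>h x\<bar> powr p)"
    using p by (intro int ci continuous_on_powr' continuous_on_rabs ch) auto
  have i3: "integrable lborel (\<lambda>x. indicator S x * norm x powr b)" by (intro int cont)
  have i4: "integrable lborel (\<lambda>x. indicator S x * DV k x)" if "k \<in> Basis" for k
    by (intro int cDV that)
  have i5: "integrable lborel (\<lambda>x. \<Sum>k\<in>Basis. indicator S x * DV k x)"
    by (intro Bochner_Integration.integrable_sum i4)
  have "\<kappa> / p * (LINT x|lborel. indicator S x * (norm x powr b * \<bar>\<phi> x\<bar> powr p))
     = (LINT x|lborel. \<kappa> / p * (indicator S x * (norm x powr b * \<bar>\<phi> x\<bar> powr p)))" by simp
  also have "\<dots> \<le> (LINT x|lborel. (\<Sum>k\<in>Basis. indicator S x * DV k x)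
        + \<kappa> powr (1 - p) / p * (indicator S x * \<bar>h x\<bar> powr p)
        + C * \<epsilon> powr (p/2) * (indicator S x * norm x powr b))"
    by (intro integral_mono pw Bochner_Integration.integrable_add integrable_mult_right i1 i2 i3 i5)
  also have "\<dots> = (\<Sum>k\<in>Basis. (LINT x|lborel. indicator S x * DV k x))
        + \<kappa> powr (1 - p) / p * (LINT x|lborel. indicator S x * \<bar>h x\<bar> powr p)
        + C * \<epsilon> powr (p/2) * (LINT x|lborel. indicator S x * norm x powr b)"
    by (simp only: Bochner_Integration.integral_add[OF Bochner_Integration.integrable_add[OF i5 integrable_mult_right[OF i2]] integrable_mult_right[OF i3]]
        Bochner_Integration.integral_add[OF i5 integrable_mult_right[OF i2]] Bochner_Integration.integral_sum[OF i4] integral_mult_right_zero)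
  finally show ?thesis using intV by (simp add: h_def)
qed

text \<open>Let \<open>\<epsilon>\<close> tend to \<open>0\<close> in the regularised inequality.\<close>

lemma rellich_inequality:
  fixes \<phi> :: "'a::euclidean_space \<Rightarrow> real"
  assumes \<phi>: "\<phi> \<in> C2c (UNIV - {0})" and p: "p > 1" and \<delta>: "\<delta> \<le> 2"
    and m: "m = real DIM('a) - (2 - \<delta>) * p" "m > 0"
    and \<kappa>: "\<kappa> = (p - 1) * real DIM('a) * m / p\<^sup>2"
  shows "\<kappa> powr p * (LINT x:UNIV - {0}|lborel. norm x powr (- ((2 - \<delta>) * p)) * \<bar>\<phi> x\<bar> powr p)
     \<le> (LINT x:UNIV - {0}|lborel. \<bar>div_op (\<lambda>x. norm x powr \<delta>) \<phi> x\<bar> powr p)"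
proof -
  define S where "S = closure {x. \<phi> x \<noteq> 0}"
  note C2 = C2c_facts[OF \<phi> open_delete[OF open_UNIV], folded S_def]
  define D where "D = (LINT x|lborel. indicator S x * (norm x powr (- ((2 - \<delta>) * p)) * \<bar>\<phi> x\<bar> powr p))"
  define N where "N = (LINT x|lborel. indicator S x * \<bar>div_op (\<lambda>x. norm x powr \<delta>) \<phi> x\<bar> powr p)"
  define J where "J = (LINT x|lborel. indicator S x * norm x powr (- ((2 - \<delta>) * p)))"
  define C where "C = (((2 - \<delta>) * (p - 1) + 2 * (m / p) * (p - 1)) / p) * m"
  have \<kappa>0: "\<kappa> > 0" using p m by (simp add: \<kappa>)
  have main: "\<kappa> / p * D - \<kappa> powr (1 - p) / p * N \<le> C * J * \<eta>" if "\<eta> > 0" for \<eta>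
  proof -
    \<comment> \<open>With \<open>\<epsilon> = \<eta> powr (2/p)\<close> the error term becomes linear in \<open>\<eta>\<close>.\<close>
    have "(\<eta> powr (2/p)) powr (p/2) = \<eta>" using that p by (simp add: powr_powr)
    then show ?thesis
      using rellich_inequality_regularised[OF \<phi> p \<delta> m \<kappa>, of "\<eta> powr (2/p)", folded S_def, folded D_def N_def J_def C_def] that
      by (simp add: mult_ac)
  qed
  have lim: "((\<lambda>\<eta>. C * J * \<eta>) \<longlongrightarrow> C * J * 0) (at_right 0)" by (intro tendsto_intros)
  have ev: "\<forall>\<^sub>F \<eta> in at_right 0. \<kappa> / p * D - \<kappa> powr (1 - p) / p * N \<le> C * J * \<eta>"
    using eventually_at_right_less by (rule eventually_mono) (rule main)
  have "\<kappa> / p * D - \<kappa> powr (1 - p) / p * N \<le> 0"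
    using tendsto_lowerbound[OF lim ev] by simp
  then have "\<kappa> * D \<le> \<kappa> powr (1 - p) * N" using p by (simp add: field_simps)
  then have "\<kappa> powr (p - 1) * (\<kappa> * D) \<le> \<kappa> powr (p - 1) * (\<kappa> powr (1 - p) * N)"
    by (intro mult_left_mono) auto
  moreover have "\<kappa> powr (p - 1) * \<kappa> = \<kappa> powr p" "\<kappa> powr (p - 1) * \<kappa> powr (1 - p) = 1"
    using \<kappa>0 powr_add[of \<kappa> "p - 1" 1] by (simp_all add: powr_add[symmetric])
  ultimately have "\<kappa> powr p * D \<le> N" by (simp add: mult.assoc[symmetric])
  moreover have "(LINT x:UNIV - {0}|lborel. norm x powr (- ((2 - \<delta>) * p)) * \<bar>\<phi> x\<bar> powr p) = D"
    unfolding D_def by (rule set_integral_eq_on_support) (use C2(2,3) in auto)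
  moreover have "(LINT x:UNIV - {0}|lborel. \<bar>div_op (\<lambda>x. norm x powr \<delta>) \<phi> x\<bar> powr p) = N"
    unfolding N_def by (rule set_integral_eq_on_support) (use C2(2) div_op_outside_support[OF \<phi>] in \<open>auto simp: S_def\<close>)
  ultimately show ?thesis by simp
qed

text \<open>The quotients in \<open>rellich_const\<close> are therefore genuine: \<open>\<phi>\<close> differs from \<open>0\<close> on a nonempty open
  set, which is not negligible.\<close>

lemma weighted_integral_pos:
  fixes \<phi> :: "'a::euclidean_space \<Rightarrow> real"
  assumes \<phi>: "\<phi> \<in> C2c (UNIV - {0})" and p: "p > 0" and ne: "\<phi> \<noteq> (\<lambda>x. 0)"
  shows "(LINT x:UNIV - {0}|lborel. norm x powr b * \<bar>\<phi> x\<bar> powr p) > 0"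
proof -
  define S where "S = closure {x. \<phi> x \<noteq> 0}"
  note C2 = C2c_facts[OF \<phi> open_delete[OF open_UNIV], folded S_def]
  let ?f = "\<lambda>x. indicator S x * (norm x powr b * \<bar>\<phi> x\<bar> powr p)"
  have "continuous_on (UNIV - {0}) (\<lambda>x. norm x powr b * \<bar>\<phi> x\<bar> powr p)"
    using p by (intro continuous_on_mult continuous_on_powr' continuous_on_rabs C2(4) continuous_intros) auto
  from borel_integrable_compact[OF C2(1) continuous_on_subset[OF this C2(2)]]
  have int: "integrable lborel ?f" by simp
  let ?U = "{x \<in> UNIV - {0}. \<phi> x \<noteq> 0}"
  have "open ?U"
  proof -
    have "?U = (UNIV - {0}) \<inter> \<phi> -` (- {0})" by auto
    then show ?thesis
      using continuous_open_preimage[OF C2(4) open_delete[OF open_UNIV], of "- {0}"] by (simp add: open_Compl)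
  qed
  moreover have "?U \<noteq> {}"
  proof -
    obtain x where "\<phi> x \<noteq> 0" using ne by auto
    moreover from this have "x \<noteq> 0" using C2(2,3) by auto
    ultimately show ?thesis by auto
  qed
  ultimately have "\<not> negligible ?U" using open_not_negligible by blast
  have "(LINT x|lborel. ?f x) \<noteq> 0"
  proof
    assume "(LINT x|lborel. ?f x) = 0"
    then have "AE x in lborel. ?f x = 0"
      using integral_nonneg_eq_0_iff_AE[OF int] by simp
    then have "AE x in lborel. x \<notin> ?U"
      by (rule eventually_mono) (use C2(3) in \<open>auto simp: indicator_def split: if_splits\<close>)
    then have "?U \<in> null_sets lborel"
      using AE_iff_null[of lborel "\<lambda>x. x \<notin> ?U"] \<open>open ?U\<close> by simp
    then show False
      using \<open>\<not> negligible ?U\<close> negligible_iff_null_sets null_sets_completionI by blast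
  qed
  moreover have "(LINT x|lborel. ?f x) \<ge> 0" by (intro integral_nonneg_AE) auto
  moreover have "(LINT x:UNIV - {0}|lborel. norm x powr b * \<bar>\<phi> x\<bar> powr p) = (LINT x|lborel. ?f x)"
    by (rule set_integral_eq_on_support) (use C2(2,3) in auto)
  ultimately show ?thesis by linarith
qed

section \<open>A twice continuously differentiable step\<close>

lemma DERIV_pos_part_power:
  "((\<lambda>t::real. max 0 t ^ (n + 2)) has_real_derivative real (n + 2) * max 0 t ^ (n + 1)) (at t)"
proof -
  consider "t > 0" | "t < 0" | "t = 0" by linarith
  then show ?thesis
  proof cases
    case 1
    have "((\<lambda>t. t ^ (n + 2)) has_real_derivative real (n + 2) * t ^ (n + 1)) (at t)"
      using DERIV_pow[of "n + 2" t] by simp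
    then have "((\<lambda>t. max 0 t ^ (n + 2)) has_real_derivative real (n + 2) * t ^ (n + 1)) (at t)"
      by (rule has_field_derivative_transform_within_open[where S = "{0<..}"]) (use 1 in auto)
    then show ?thesis using 1 by (simp add: max_def)
  next
    case 2
    have "((\<lambda>t. 0) has_real_derivative 0) (at t)" by simp
    then have "((\<lambda>t. max 0 t ^ (n + 2)) has_real_derivative 0) (at t)"
      by (rule has_field_derivative_transform_within_open[where S = "{..<0}"]) (use 2 in auto)
    then show ?thesis using 2 by (simp add: max_def)
  next
    case 3
    have "((\<lambda>h::real. max 0 h ^ (n + 1)) \<longlongrightarrow> max 0 0 ^ (n + 1)) (at 0)"
      by (intro tendsto_intros)
    then have "((\<lambda>h::real. max 0 h ^ (n + 1)) \<longlongrightarrow> 0) (at 0)" by simp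
    moreover have "max 0 h ^ (n + 1) = max 0 h ^ (n + 2) / h" if "h \<noteq> 0" for h :: real
      using that by (cases "h > 0") (auto simp: max_def)
    then have "\<forall>\<^sub>F h::real in at 0. max 0 h ^ (n + 1) = max 0 h ^ (n + 2) / h"
      by (auto simp: eventually_at_filter)
    ultimately have "((\<lambda>h::real. max 0 h ^ (n + 2) / h) \<longlongrightarrow> 0) (at 0)"
      by (rule Lim_transform_eventually)
    then show ?thesis using 3 by (simp add: has_field_derivative_iff)
  qed
qed

text \<open>The cube \<open>q\<close> of the positive part is \<open>C\<^sup>2\<close>, equals \<open>0\<close> for \<open>t \<le> 0\<close> and is at least \<open>1\<close> for
  \<open>t \<ge> 1\<close>; hence \<open>q (1 - q t)\<close> steps down from \<open>1\<close> to \<open>0\<close>.\<close>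

lemma C2_step_function:
  obtains h h1 h2 :: "real \<Rightarrow> real" and B
  where "\<And>t. (h has_real_derivative h1 t) (at t)" "\<And>t. (h1 has_real_derivative h2 t) (at t)"
    "continuous_on UNIV h2" "\<And>t. t \<le> 0 \<Longrightarrow> h t = 1 \<and> h1 t = 0 \<and> h2 t = 0"
    "\<And>t. t \<ge> 1 \<Longrightarrow> h t = 0 \<and> h1 t = 0 \<and> h2 t = 0"
    "\<And>t. 0 \<le> h t" "\<And>t. \<bar>h t\<bar> \<le> B \<and> \<bar>h1 t\<bar> \<le> B \<and> \<bar>h2 t\<bar> \<le> B"
proof -
  define q q1 q2 :: "real \<Rightarrow> real"
    where "q t = max 0 t ^ 3" and "q1 t = 3 * max 0 t ^ 2" and "q2 t = 6 * max 0 t" for t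
  have q: "(q has_real_derivative q1 t) (at t)" "(q1 has_real_derivative q2 t) (at t)" for t
    using DERIV_pos_part_power[of 1 t] DERIV_cmult[OF DERIV_pos_part_power[of 0 t], of 3]
    by (simp_all add: q_def[abs_def] q1_def[abs_def] q2_def numeral_eq_Suc)
  define h h1 h2 where "h t = q (1 - q t)" and "h1 t = - (q1 (1 - q t) * q1 t)"
    and "h2 t = q2 (1 - q t) * (q1 t)\<^sup>2 - q1 (1 - q t) * q2 t" for t
  have h: "(h has_real_derivative h1 t) (at t)" for t
    unfolding h_def[abs_def] h1_def
    by (rule DERIV_cong, rule DERIV_chain2[OF q(1)], rule DERIV_diff[OF DERIV_const q(1)]) simp
  have h1: "(h1 has_real_derivative h2 t) (at t)" for t
  proof -
    have "((\<lambda>t. q1 (1 - q t)) has_real_derivative q2 (1 - q t) * (0 - q1 t)) (at t)"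
      by (rule DERIV_chain2[OF q(2)], rule DERIV_diff[OF DERIV_const q(1)])
    from DERIV_minus[OF DERIV_mult[OF this q(2)]] show ?thesis
      by (simp add: h1_def[abs_def] h2_def power2_eq_square algebra_simps)
  qed
  have c: "continuous_on UNIV h2"
    unfolding h2_def[abs_def] q_def q1_def q2_def by (intro continuous_intros)
  have l: "h t = 1 \<and> h1 t = 0 \<and> h2 t = 0" if "t \<le> 0" for t
    using that by (simp add: h_def h1_def h2_def q_def q1_def q2_def)
  have u: "h t = 0 \<and> h1 t = 0 \<and> h2 t = 0" if "t \<ge> 1" for t
  proof -
    have "q t \<ge> 1" using that by (simp add: q_def)
    then show ?thesis by (simp add: h_def h1_def h2_def q_def[of "1 - q t"] q1_def[of "1 - q t"] q2_def[of "1 - q t"])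
  qed
  have bd: "\<exists>B. \<forall>t\<in>{0..1}. \<bar>f t\<bar> \<le> B" if "continuous_on UNIV f" for f :: "real \<Rightarrow> real"
    using compact_imp_bounded[OF compact_continuous_image[OF continuous_on_subset[OF that subset_UNIV] compact_Icc[of 0 1]]]
    unfolding bounded_iff by auto
  have ch: "continuous_on UNIV h" "continuous_on UNIV h1"
    using DERIV_isCont[OF h] DERIV_isCont[OF h1] by (auto intro!: continuous_at_imp_continuous_on)
  obtain B0 where B0: "\<forall>t\<in>{0..1}. \<bar>h t\<bar> \<le> B0" using bd[OF ch(1)] by blast
  obtain B1 where B1: "\<forall>t\<in>{0..1}. \<bar>h1 t\<bar> \<le> B1" using bd[OF ch(2)] by blast
  obtain B2 where B2: "\<forall>t\<in>{0..1}. \<bar>h2 t\<bar> \<le> B2" using bd[OF c] by blast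
  define B where "B = 1 + \<bar>B0\<bar> + \<bar>B1\<bar> + \<bar>B2\<bar>"
  have "\<bar>h t\<bar> \<le> B \<and> \<bar>h1 t\<bar> \<le> B \<and> \<bar>h2 t\<bar> \<le> B" for t
  proof -
    consider "t \<le> 0" | "t \<ge> 1" | "t \<in> {0..1}" by fastforce
    then show ?thesis
    proof cases
      case 3
      then have "\<bar>h t\<bar> \<le> B0" "\<bar>h1 t\<bar> \<le> B1" "\<bar>h2 t\<bar> \<le> B2" using B0 B1 B2 by blast+
      then show ?thesis unfolding B_def by linarith
    qed (use l[of t] u[of t] in \<open>auto simp: B_def\<close>)
  qed
  moreover have "0 \<le> h t" for t by (simp add: h_def q_def)
  ultimately show ?thesis by (intro that[OF h h1 c l u])  auto
qed

section \<open>The operator on radial functions\<close>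

lemma has_derivative_radial:
  fixes x :: "'a::euclidean_space"
  assumes "x \<noteq> 0" "(F has_real_derivative F') (at (ln (norm x)))"
  shows "((\<lambda>y. F (ln (norm y))) has_derivative (\<lambda>v. F' * (x \<bullet> v) / (norm x)\<^sup>2)) (at x)"
proof -
  have 1: "(norm has_derivative (\<lambda>v. v \<bullet> sgn x)) (at x)"
    using has_derivative_norm[OF assms(1)] by (simp add: inner_commute)
  have "(ln has_real_derivative inverse (norm x)) (at (norm x))"
    using assms(1) by (auto intro!: derivative_eq_intros simp: field_simps)
  from DERIV_chain2[OF assms(2) this]
  have "((\<lambda>r. F (ln r)) has_derivative (*) (F' * inverse (norm x))) (at (norm x))"
    by (simp add: has_field_derivative_def)
  from has_derivative_compose[OF 1 this]
  show ?thesis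
    by (rule has_derivative_eq_rhs)
      (auto simp: fun_eq_iff sgn_div_norm inner_commute power2_eq_square divide_inverse)
qed

lemma has_derivative_radial_inner:
  fixes x :: "'a::euclidean_space"
  assumes "x \<noteq> 0" "(F has_real_derivative F') (at (ln (norm x)))"
  shows "((\<lambda>y. F (ln (norm y)) * (y \<bullet> k)) has_derivative
    (\<lambda>v. F' * (x \<bullet> v) * (x \<bullet> k) / (norm x)\<^sup>2 + F (ln (norm x)) * (v \<bullet> k))) (at x)"
  by (rule has_derivative_eq_rhs, rule has_derivative_mult[OF has_derivative_radial[OF assms]],
      rule has_derivative_inner_left[OF has_derivative_ident]) (auto simp: fun_eq_iff)

lemma C1_onI:
  assumes "open S" "\<And>x. x \<in> S \<Longrightarrow> (f has_derivative f' x) (at x)"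
    "\<And>k. k \<in> Basis \<Longrightarrow> continuous_on S (\<lambda>x. f' x k)"
  shows "C1_on S f"
proof -
  have p: "partial k f x = f' x k" if "x \<in> S" for x k
    using partial_eqI[OF has_partial_if_has_derivative[OF assms(2)[OF that]]] .
  show ?thesis unfolding C1_on_def
  proof (intro conjI ballI)
    fix x assume "x \<in> S" then show "f differentiable at x" using assms(2) unfolding differentiable_def by blast
  next
    fix k :: 'a assume "k \<in> Basis"
    from assms(3)[OF this] show "continuous_on S (partial k f)" by (rule continuous_on_eq) (simp add: p)
  qed
qed

text \<open>In the variable \<open>t = ln r\<close> the gradient of \<open>g (ln r)\<close> is \<open>x\<close> times a function of \<open>t\<close>, so both
  derivatives have the shape \<open>F (ln r)\<close> or \<open>F (ln r) (x \<bullet> k)\<close>, and powers of \<open>r\<close> become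
  exponentials. The second-order operator turns into one with constant coefficients.\<close>

lemma radial_C2c:
  fixes g g1 g2 :: "real \<Rightarrow> real"
  assumes g: "\<And>t. (g has_real_derivative g1 t) (at t)" "\<And>t. (g1 has_real_derivative g2 t) (at t)"
    and c: "continuous_on UNIV g2" and 0: "\<And>t. t < A \<or> t > B \<Longrightarrow> g t = 0"
  defines "\<phi> \<equiv> (\<lambda>x::'a::euclidean_space. if x = 0 then 0 else g (ln (norm x)))"
  shows "\<phi> \<in> C2c (UNIV - {0})"
    and "\<And>x. x \<noteq> 0 \<Longrightarrow> div_op (\<lambda>x. norm x powr \<delta>) \<phi> x
      = - (norm x powr (\<delta> - 2) * (g2 (ln (norm x)) + (real DIM('a) + \<delta> - 2) * g1 (ln (norm x))))"
proof -
  let ?\<Omega> = "UNIV - {0::'a}"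
  have op: "open ?\<Omega>" by auto
  have cg1: "continuous_on UNIV g1"
    using DERIV_isCont[OF g(2)] by (auto intro!: continuous_at_imp_continuous_on)
  have clog: "continuous_on ?\<Omega> (\<lambda>x. F (ln (norm x)))" if "continuous_on UNIV F" for F :: "real \<Rightarrow> real"
    by (rule continuous_on_compose2[OF that]) (auto intro!: continuous_intros)
  have d\<phi>: "(\<phi> has_derivative (\<lambda>v. g1 (ln (norm x)) * (x \<bullet> v) / (norm x)\<^sup>2)) (at x)" if "x \<in> ?\<Omega>" for x
    by (rule has_derivative_transform_within_open[OF has_derivative_radial[OF _ g(1)] op])
      (use that in \<open>auto simp: \<phi>_def\<close>)
  have C1: "C1_on ?\<Omega> \<phi>"
    by (rule C1_onI[OF op d\<phi>]) (auto intro!: continuous_intros clog cg1)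
  define G G' where "G t = g1 t * exp (- 2 * t)" and "G' t = (g2 t - 2 * g1 t) * exp (- 2 * t)" for t
  have G: "(G has_real_derivative G' t) (at t)" for t
    unfolding G_def[abs_def] G'_def by (auto intro!: derivative_eq_intros g simp: algebra_simps)
  have pk: "partial k \<phi> x = G (ln (norm x)) * (x \<bullet> k)" if "x \<in> ?\<Omega>" for x k
  proof -
    have "exp (- 2 * ln (norm x)) = inverse ((norm x)\<^sup>2)"
      using that by (simp add: exp_minus exp_double)
    then show ?thesis
      using partial_eqI[OF has_partial_if_has_derivative[OF d\<phi>[OF that], of k]]
      by (simp add: G_def divide_inverse)
  qed
  have dp: "(partial k \<phi> has_derivative
      (\<lambda>v. G' (ln (norm x)) * (x \<bullet> v) * (x \<bullet> k) / (norm x)\<^sup>2 + G (ln (norm x)) * (v \<bullet> k))) (at x)"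
    if "x \<in> ?\<Omega>" for x k
    by (rule has_derivative_transform_within_open[OF has_derivative_radial_inner[OF _ G] op])
      (use that pk in auto)
  have cG: "continuous_on UNIV G" "continuous_on UNIV G'"
    unfolding G_def[abs_def] G'_def[abs_def] by (intro continuous_intros cg1 c)+
  have "C1_on ?\<Omega> (partial k \<phi>)" for k
    by (rule C1_onI[OF op dp]) (auto intro!: continuous_intros clog cG)
  then have C2: "C2_on ?\<Omega> \<phi>" using C1 by (simp add: C2_on_def)
  let ?R = "cball 0 (exp B) - ball 0 (exp A) :: 'a set"
  have "closed ?R" by (intro closed_Diff closed_cball open_ball)
  have "{x. \<phi> x \<noteq> 0} \<subseteq> ?R"
  proof
    fix x assume "x \<in> {x. \<phi> x \<noteq> 0}"
    then have x: "x \<noteq> 0" "g (ln (norm x)) \<noteq> 0" by (auto simp: \<phi>_def split: if_splits)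
    have ln_le_iff_exp: "ln (norm x) \<le> B \<longleftrightarrow> norm x \<le> exp B"
      using x exp_le_cancel_iff[of "ln (norm x)" B] by simp
    from x have "A \<le> ln (norm x)" "ln (norm x) \<le> B" using 0[of "ln (norm x)"] by force+
    then show "x \<in> ?R" using x by (simp add: ln_ge_iff ln_le_iff_exp)
  qed
  then have sub: "closure {x. \<phi> x \<noteq> 0} \<subseteq> ?R" by (rule closure_minimal) fact
  have "bounded ?R" using bounded_subset[OF bounded_cball] by blast
  then have "compact (closure {x. \<phi> x \<noteq> 0})"
    using sub bounded_subset by (auto simp: compact_eq_bounded_closed)
  moreover have "closure {x. \<phi> x \<noteq> 0} \<subseteq> ?\<Omega>" using sub by auto
  ultimately show "\<phi> \<in> C2c ?\<Omega>" using C2 by (simp add: C2c_def)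
  fix x :: 'a assume x: "x \<noteq> 0"
  define E E' where "E t = exp ((\<delta> - 2) * t) * g1 t"
    and "E' t = exp ((\<delta> - 2) * t) * (g2 t + (\<delta> - 2) * g1 t)" for t
  have E: "(E has_real_derivative E' t) (at t)" for t
    unfolding E_def[abs_def] E'_def by (auto intro!: derivative_eq_intros g simp: algebra_simps)
  let ?t = "ln (norm x)"
  have "partial k (\<lambda>y. norm y powr \<delta> * partial k \<phi> y) x = E' ?t * (x \<bullet> k)\<^sup>2 / (norm x)\<^sup>2 + E ?t"
    if "k \<in> Basis" for k
  proof -
    have "((\<lambda>y. norm y powr \<delta> * partial k \<phi> y) has_derivative
      (\<lambda>v. E' ?t * (x \<bullet> v) * (x \<bullet> k) / (norm x)\<^sup>2 + E ?t * (v \<bullet> k))) (at x)"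
    proof (rule has_derivative_transform_within_open[OF has_derivative_radial_inner[OF _ E] op])
      fix y assume y: "y \<in> ?\<Omega>"
      have "norm y powr \<delta> * exp (- 2 * ln (norm y)) = exp ((\<delta> - 2) * ln (norm y))"
        using y by (simp add: powr_def exp_add[symmetric] algebra_simps)
      then show "E (ln (norm y)) * (y \<bullet> k) = norm y powr \<delta> * partial k \<phi> y"
        using y by (simp add: pk E_def G_def mult_ac)
    qed (use x in auto)
    from partial_eqI[OF has_partial_if_has_derivative[OF this, of k]]
    show ?thesis using that by (simp add: power2_eq_square)
  qed
  then have "div_op (\<lambda>x. norm x powr \<delta>) \<phi> x
      = - ((E' ?t / (norm x)\<^sup>2) * (\<Sum>k\<in>Basis. (x \<bullet> k)\<^sup>2) + real DIM('a) * E ?t)"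
    by (simp add: div_op_def sum.distrib sum_distrib_left)
  also have "(\<Sum>k\<in>Basis. (x \<bullet> k)\<^sup>2) = (norm x)\<^sup>2"
    unfolding power2_norm_eq_inner euclidean_inner[of x x] by (simp only: power2_eq_square)
  also have "E' ?t / (norm x)\<^sup>2 * (norm x)\<^sup>2 = E' ?t" using x by simp
  finally show "div_op (\<lambda>x. norm x powr \<delta>) \<phi> x
      = - (norm x powr (\<delta> - 2) * (g2 ?t + (real DIM('a) + \<delta> - 2) * g1 ?t))"
    using x by (simp add: E_def E'_def powr_def algebra_simps)
qed

section \<open>Functions that almost attain the constant\<close>

lemma measure_lborel_cball:
  assumes "r \<ge> 0"
  shows "measure lborel (cball (0::'a::euclidean_space) r) = unit_ball_vol (DIM('a)) * r ^ DIM('a)"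
  using content_cball[OF assms, of "0::'a"] by simp

text \<open>On the shell \<open>n \<le> ln r \<le> n + 1\<close> the integrand is at least its value at the outer radius, and
  this value times the volume of the shell does not depend on \<open>n\<close>. So each shell adds \<open>c\<close>.\<close>

lemma shell_integral_lower_bound:
  obtains c where "c > 0" and "\<And>n. real n * c \<le>
    (LINT x|lborel. indicator (cball 0 (exp (real n)) - ball 0 1) x * norm (x::'a::euclidean_space) powr (- real DIM('a)))"
proof -
  let ?d = "DIM('a)"
  define A where "A n = cball (0::'a) (exp (real n)) - ball 0 1" for n
  define I where "I n = (LINT x|lborel. indicator (A n) x * norm x powr (- real ?d))" for n
  define T where "T n = cball (0::'a) (exp (real (Suc n))) - cball 0 (exp (real n))" for n
  define c where "c = unit_ball_vol ?d * (1 - exp (- real ?d))"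
  have c: "c > 0" by (simp add: c_def)
  have int: "integrable lborel (\<lambda>x. indicator (A n) x * norm x powr (- real ?d))" for n
  proof -
    have "compact (A n)" unfolding A_def by (intro compact_diff) auto
    moreover have "continuous_on (A n) (\<lambda>x. norm x powr (- real ?d))"
      by (intro continuous_intros) (auto simp: A_def)
    ultimately show ?thesis using borel_integrable_compact[of "A n" "\<lambda>x. norm x powr (- real ?d)"] by simp
  qed
  have fin: "emeasure lborel (T n) < \<infinity>" for n
    unfolding T_def by (intro emeasure_bounded_finite bounded_diff bounded_cball)
  have sets: "T n \<in> sets lborel" for n by (simp add: T_def)
  have Tc: "exp (- real (Suc n) * real ?d) * measure lborel (T n) = c" for n
  proof -
    have "measure lborel (T n) = measure lborel (cball (0::'a) (exp (real (Suc n)))) - measure lborel (cball (0::'a) (exp (real n)))"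
      unfolding T_def using emeasure_bounded_finite[OF bounded_cball[of "0::'a" "exp (real (Suc n))"]]
      by (intro measure_Diff) (auto intro: order_trans simp del: mem_cball simp add: subset_cball subsetD)
    also have "\<dots> = unit_ball_vol ?d * (exp (real (Suc n) * real ?d) - exp (real n * real ?d))"
      by (simp only: measure_lborel_cball exp_ge_zero exp_of_nat2_mult[symmetric] right_diff_distrib)
    finally have M: "measure lborel (T n) = unit_ball_vol ?d * (exp (real (Suc n) * real ?d) - exp (real n * real ?d))" .
    have "exp (- real (Suc n) * real ?d) * exp (real (Suc n) * real ?d) = 1"
      "exp (- real (Suc n) * real ?d) * exp (real n * real ?d) = exp (- real ?d)"
      by (simp_all add: exp_add[symmetric] algebra_simps)
    then have "c = unit_ball_vol ?d * (exp (- real (Suc n) * real ?d) * exp (real (Suc n) * real ?d)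
        - exp (- real (Suc n) * real ?d) * exp (real n * real ?d))" by (simp only: c_def)
    then show ?thesis unfolding M by (simp only: right_diff_distrib mult.left_commute)
  qed
  have step: "I n + c \<le> I (Suc n)" for n
  proof -
    have "I n + c = (LINT x|lborel. indicator (A n) x * norm x powr (- real ?d)
        + exp (- real (Suc n) * real ?d) * indicator (T n) x)"
      unfolding I_def Tc[of n, symmetric] using fin[of n] sets[of n] int[of n]
      by (subst Bochner_Integration.integral_add) auto
    also have "\<dots> \<le> I (Suc n)" unfolding I_def
    proof (intro integral_mono Bochner_Integration.integrable_add int)
      show "integrable lborel (\<lambda>x. exp (- real (Suc n) * real ?d) * indicator (T n) x)"
        using fin[of n] sets[of n] by (intro integrable_mult_right integrable_real_indicator) auto
      fix x :: 'a
      consider "x \<in> A n" | "x \<in> T n" | "x \<notin> A n" "x \<notin> T n" by blast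
      then show "indicator (A n) x * norm x powr (- real ?d) + exp (- real (Suc n) * real ?d) * indicator (T n) x
        \<le> indicator (A (Suc n)) x * norm x powr (- real ?d)"
      proof cases
        case 1
        then have "x \<notin> T n" "x \<in> A (Suc n)"
          by (auto simp: A_def T_def intro: order_trans)
        then show ?thesis using 1 by simp
      next
        case 2
        have "(1::real) \<le> exp (real n)" by simp
        then have *: "x \<notin> A n" "x \<in> A (Suc n)" "x \<noteq> 0" "norm x \<le> exp (real (Suc n))"
          using 2 by (auto simp: A_def T_def simp del: one_le_exp_iff)
        have "exp (real (Suc n)) powr (- real ?d) \<le> norm x powr (- real ?d)"
          using * by (intro powr_mono2') auto
        then show ?thesis using * 2 by (simp add: powr_def algebra_simps)
      next
        case 3 then show ?thesis by simp
      qed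
    qed
    finally show ?thesis .
  qed
  have "real n * c \<le> I n" for n
  proof (induction n)
    case 0
    show ?case unfolding I_def by (simp add: integral_nonneg_AE)
  next
    case (Suc n) then show ?case using step[of n] by (simp add: algebra_simps)
  qed
  then show ?thesis using that[OF c] unfolding I_def A_def by blast
qed

text \<open>Here \<open>\<phi> n\<close> is \<open>r\<close> to the power \<open>- s\<close> times \<open>\<eta> (ln r)\<close>, where \<open>s = m / p\<close> and \<open>\<eta>\<close> is a product of
  two steps that is \<open>1\<close> on the interval from \<open>0\<close> to \<open>n\<close>. Its image under \<open>H\<close> is a power of \<open>r\<close>
  times \<open>L (ln r)\<close>, where \<open>L = \<kappa> \<eta>\<close> plus terms with derivatives of \<open>\<eta>\<close> that vanish on the
  plateau and are bounded independently of \<open>n\<close>. On the two transition shells the integrand is at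
  most \<open>R\<close>, whose integral does not depend on \<open>n\<close>.\<close>

lemma rellich_test_functions:
  fixes p \<delta> m \<kappa> :: real
  assumes p: "p > 1"
    and m: "m = real DIM('a::euclidean_space) - (2 - \<delta>) * p"
    and \<kappa>: "\<kappa> = (p - 1) * real DIM('a::euclidean_space) * m / p\<^sup>2" and \<kappa>0: "\<kappa> \<ge> 0"
  obtains \<phi> :: "nat \<Rightarrow> 'a::euclidean_space \<Rightarrow> real" and C c where "c > 0" "C \<ge> 0" "\<And>n. \<phi> n \<in> C2c (UNIV - {0})"
    "\<And>n. (LINT x:UNIV - {0}|lborel. \<bar>div_op (\<lambda>x. norm x powr \<delta>) (\<phi> n) x\<bar> powr p)
      \<le> \<kappa> powr p * (LINT x:UNIV - {0}|lborel. norm x powr (- ((2 - \<delta>) * p)) * \<bar>\<phi> n x\<bar> powr p) + C"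
    "\<And>n. real n * c \<le> (LINT x:UNIV - {0}|lborel. norm x powr (- ((2 - \<delta>) * p)) * \<bar>\<phi> n x\<bar> powr p)"
proof -
  obtain h h1 h2 :: "real \<Rightarrow> real" and B where
    h: "\<And>t. (h has_real_derivative h1 t) (at t)" "\<And>t. (h1 has_real_derivative h2 t) (at t)"
    and ch2: "continuous_on UNIV h2" and hl: "\<And>t. t \<le> 0 \<Longrightarrow> h t = 1 \<and> h1 t = 0 \<and> h2 t = 0"
    and hr: "\<And>t. t \<ge> 1 \<Longrightarrow> h t = 0 \<and> h1 t = 0 \<and> h2 t = 0"
    and h0: "\<And>t. 0 \<le> h t" and hB: "\<And>t. \<bar>h t\<bar> \<le> B \<and> \<bar>h1 t\<bar> \<le> B \<and> \<bar>h2 t\<bar> \<le> B"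
  proof (rule C2_step_function, goal_cases)
    case (1 h h1 h2 B) from 1(2-) show ?case by (rule 1(1))
  qed
  let ?d = "real DIM('a)"
  define s where "s = m / p"
  define \<beta> where "\<beta> = ?d + \<delta> - 2"
  have s: "s = ?d / p - (2 - \<delta>)" using p by (simp add: s_def m diff_divide_distrib)
  \<comment> \<open>This choice of \<open>s\<close> is the one with \<open>H (r powr (- s)) = \<kappa> r powr (\<delta> - 2 - s)\<close>.\<close>
  have s\<kappa>: "s * \<beta> - s\<^sup>2 = \<kappa>"
  proof -
    have "s * \<beta> - s\<^sup>2 = s * (\<beta> - s)" by (simp add: power2_eq_square algebra_simps)
    also have "\<beta> - s = ?d * (p - 1) / p" using p by (simp add: \<beta>_def s field_simps)
    finally show ?thesis by (simp add: \<kappa> s_def power2_eq_square)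
  qed
  define \<eta> \<eta>1 \<eta>2 where "\<eta> n t = h (t - real n) * h (- t)"
    and "\<eta>1 n t = h1 (t - real n) * h (- t) - h (t - real n) * h1 (- t)"
    and "\<eta>2 n t = h2 (t - real n) * h (- t) - 2 * (h1 (t - real n) * h1 (- t)) + h (t - real n) * h2 (- t)" for n t
  have hs: "((\<lambda>t. h (t - real n)) has_real_derivative h1 (t - real n)) (at t)"
      "((\<lambda>t. h1 (t - real n)) has_real_derivative h2 (t - real n)) (at t)" for n t
    using DERIV_shift[of h "h1 (t - real n)" t "- real n"] DERIV_shift[of h1 "h2 (t - real n)" t "- real n"] h
    by simp_all
  have hm: "((\<lambda>t. h (- t)) has_real_derivative - h1 (- t)) (at t)"
      "((\<lambda>t. h1 (- t)) has_real_derivative - h2 (- t)) (at t)" for t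
    using DERIV_mirror[of h "h1 (- t)" t] DERIV_mirror[of h1 "h2 (- t)" t] h by simp_all
  have \<eta>1: "(\<eta> n has_real_derivative \<eta>1 n t) (at t)" for n t
    unfolding \<eta>_def[abs_def] \<eta>1_def using DERIV_mult[OF hs(1)[of n t] hm(1)] by (simp add: algebra_simps)
  have \<eta>2: "(\<eta>1 n has_real_derivative \<eta>2 n t) (at t)" for n t
    unfolding \<eta>1_def[abs_def] \<eta>2_def
    using DERIV_diff[OF DERIV_mult[OF hs(2)[of n t] hm(1)] DERIV_mult[OF hs(1)[of n t] hm(2)]] by (simp add: algebra_simps)
  define g g1 g2 where "g n t = exp (- s * t) * \<eta> n t"
    and "g1 n t = exp (- s * t) * (\<eta>1 n t - s * \<eta> n t)"
    and "g2 n t = exp (- s * t) * (\<eta>2 n t - 2 * s * \<eta>1 n t + s\<^sup>2 * \<eta> n t)" for n t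
  have g: "(g n has_real_derivative g1 n t) (at t)" "(g1 n has_real_derivative g2 n t) (at t)" for n t
    unfolding g_def[abs_def] g1_def[abs_def] g2_def
    by (auto intro!: derivative_eq_intros \<eta>1 \<eta>2 simp: algebra_simps power2_eq_square)
  have cont: "continuous_on UNIV h" "continuous_on UNIV h1"
    using DERIV_isCont[OF h(1)] DERIV_isCont[OF h(2)] by (auto intro!: continuous_at_imp_continuous_on)
  have cc: "continuous_on UNIV (\<lambda>t. f (t - real n))" "continuous_on UNIV (\<lambda>t. f (- t))"
    if "continuous_on UNIV f" for f :: "real \<Rightarrow> real" and n
    by (rule continuous_on_compose2[OF that]; auto intro!: continuous_intros)+
  have cg2: "continuous_on UNIV (g2 n)" for n
    unfolding g2_def[abs_def] \<eta>_def \<eta>1_def \<eta>2_def by (intro continuous_intros cc cont ch2)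
  have out: "\<eta> n t = 0 \<and> \<eta>1 n t = 0 \<and> \<eta>2 n t = 0" if "t < -1 \<or> t > real n + 1" for n t
    using hr[of "- t"] hr[of "t - real n"] that by (auto simp: \<eta>_def \<eta>1_def \<eta>2_def)
  define \<phi> where "\<phi> n = (\<lambda>x::'a. if x = 0 then 0 else g n (ln (norm x)))" for n
  note rad = radial_C2c[where 'a = 'a, OF g cg2, of "-1" "real n + 1" n for n, folded \<phi>_def]
  have C2: "\<phi> n \<in> C2c (UNIV - {0})" for n
    by (rule rad(1)) (use out in \<open>auto simp: g_def\<close>)
  define L where "L n t = - \<eta>2 n t + (2 * s - \<beta>) * \<eta>1 n t + \<kappa> * \<eta> n t" for n t
  have div: "\<bar>div_op (\<lambda>x. norm x powr \<delta>) (\<phi> n) x\<bar> powr p = norm x powr (- ?d) * \<bar>L n (ln (norm x))\<bar> powr p"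
    if x: "x \<noteq> 0" for n x
  proof -
    let ?t = "ln (norm x)"
    have "div_op (\<lambda>x. norm x powr \<delta>) (\<phi> n) x = - (norm x powr (\<delta> - 2) * (g2 n ?t + (?d + \<delta> - 2) * g1 n ?t))"
      by (rule rad(2)) (use out x in \<open>auto simp: g_def\<close>)
    also have "g2 n ?t + (?d + \<delta> - 2) * g1 n ?t = - (exp (- s * ?t) * L n ?t)"
      unfolding g1_def g2_def L_def \<beta>_def[symmetric] s\<kappa>[symmetric] by (simp add: algebra_simps power2_eq_square)
    also have "exp (- s * ?t) = norm x powr (- s)" using x by (simp add: powr_def)
    finally have "\<bar>div_op (\<lambda>x. norm x powr \<delta>) (\<phi> n) x\<bar> = norm x powr (\<delta> - 2 - s) * \<bar>L n ?t\<bar>"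
      by (simp add: abs_mult powr_add[symmetric])
    moreover have "(\<delta> - 2 - s) * p = - ?d" using p by (simp add: s field_simps)
    ultimately show ?thesis by (simp add: powr_mult powr_powr)
  qed
  have den: "norm x powr (- ((2 - \<delta>) * p)) * \<bar>\<phi> n x\<bar> powr p = norm x powr (- ?d) * \<eta> n (ln (norm x)) powr p"
    if x: "x \<noteq> 0" for n x
  proof -
    let ?t = "ln (norm x)"
    have "\<bar>\<phi> n x\<bar> = norm x powr (- s) * \<eta> n ?t"
      using x h0 by (simp add: \<phi>_def g_def powr_def \<eta>_def abs_mult)
    then have "norm x powr (- ((2 - \<delta>) * p)) * \<bar>\<phi> n x\<bar> powr p
      = norm x powr (- ((2 - \<delta>) * p) + - s * p) * \<eta> n ?t powr p"
      using powr_add[of "norm x" "- ((2 - \<delta>) * p)" "- s * p"] by (simp add: powr_mult powr_powr)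
    also have "- ((2 - \<delta>) * p) + - s * p = - ?d" using p by (simp add: s field_simps)
    finally show ?thesis .
  qed
  define M where "M = 4 * B\<^sup>2 + \<bar>2 * s - \<beta>\<bar> * (2 * B\<^sup>2) + \<kappa> * B\<^sup>2"
  have B0: "B \<ge> 0" using hB[of 0] by linarith
  have LM: "\<bar>L n t\<bar> \<le> M" for n t
  proof -
    have mult: "\<bar>x * y\<bar> \<le> B\<^sup>2" if "\<bar>x\<bar> \<le> B" "\<bar>y\<bar> \<le> B" for x y :: real
      using mult_mono[OF that B0] by (simp add: abs_mult power2_eq_square)
    have b0: "\<bar>\<eta> n t\<bar> \<le> B\<^sup>2" unfolding \<eta>_def using hB by (intro mult) auto
    have b1: "\<bar>\<eta>1 n t\<bar> \<le> 2 * B\<^sup>2"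
      unfolding \<eta>1_def using mult[of "h1 (t - real n)" "h (- t)"] mult[of "h (t - real n)" "h1 (- t)"] hB
      by (smt (verit))
    have b2: "\<bar>\<eta>2 n t\<bar> \<le> 4 * B\<^sup>2"
      unfolding \<eta>2_def using mult[of "h2 (t - real n)" "h (- t)"] mult[of "h (t - real n)" "h2 (- t)"]
        mult[of "h1 (t - real n)" "h1 (- t)"] hB by (smt (verit))
    have "\<bar>(2 * s - \<beta>) * \<eta>1 n t\<bar> \<le> \<bar>2 * s - \<beta>\<bar> * (2 * B\<^sup>2)"
      using b1 by (simp add: abs_mult mult_left_mono)
    moreover have "\<bar>\<kappa> * \<eta> n t\<bar> \<le> \<kappa> * B\<^sup>2"
      using b0 \<kappa>0 by (simp add: abs_mult mult_left_mono)
    ultimately show ?thesis using b2 unfolding L_def M_def by linarith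
  qed
  define C where "C = M powr p * (exp ?d * (2 * unit_ball_vol ?d))"
  have C0: "C \<ge> 0" by (simp add: C_def)
  define N where "N n x = indicator (UNIV - {0}) x * \<bar>div_op (\<lambda>x. norm x powr \<delta>) (\<phi> n) x\<bar> powr p" for n and x :: 'a
  define D where "D n x = indicator (UNIV - {0}) x * (norm x powr (- ((2 - \<delta>) * p)) * \<bar>\<phi> n x\<bar> powr p)" for n and x :: 'a
  define R where "R n x = M powr p * (exp ?d * indicator (cball 0 1) x
      + exp (- (real n * ?d)) * indicator (cball 0 (exp (real n + 1))) x)" for n and x :: 'a
  have NDR: "N n x \<le> \<kappa> powr p * D n x + R n x" for n x
  proof (cases "x = 0")
    case True then show ?thesis by (simp add: N_def D_def R_def)
  next
    case False
    let ?t = "ln (norm x)"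
    have N: "N n x = norm x powr (- ?d) * \<bar>L n ?t\<bar> powr p" using False div by (simp add: N_def)
    have D: "D n x = norm x powr (- ?d) * \<eta> n ?t powr p" using False den by (simp add: D_def)
    have D0: "D n x \<ge> 0" by (simp add: D)
    have R0: "R n x \<ge> 0" by (simp add: R_def)
    have LMp: "\<bar>L n ?t\<bar> powr p \<le> M powr p" using LM p by (intro powr_mono2) auto
    have nx: "norm x \<le> exp y \<longleftrightarrow> ?t \<le> y" for y
      using exp_le_cancel_iff[of ?t y] False by simp
    \<comment> \<open>Outside the support, inner transition, plateau, outer transition.\<close>
    consider "?t < -1 \<or> ?t > real n + 1" | "-1 \<le> ?t" "?t \<le> 0" | "0 \<le> ?t" "?t \<le> real n" | "real n \<le> ?t" "?t \<le> real n + 1"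
      by linarith
    then show ?thesis
    proof cases
      case 1
      then have "L n ?t = 0" using out by (simp add: L_def)
      then show ?thesis using D0 R0 by (simp add: N)
    next
      case 2
      have "norm x powr (- ?d) = exp (- ?d * ?t)" using False by (simp add: powr_def)
      also have "\<dots> \<le> exp ?d" using 2 mult_left_mono[of "- 1" ?t ?d] by simp
      finally have "N n x \<le> exp ?d * M powr p" unfolding N using LMp by (intro mult_mono) auto
      moreover have "x \<in> cball 0 1" using 2 nx[of 0] by simp
      then have "exp ?d * M powr p \<le> R n x" by (simp add: R_def distrib_left mult.commute)
      ultimately have "N n x \<le> R n x" by linarith
      then show ?thesis using D0 by (simp add: add_increasing)
    next
      case 3
      then have "\<eta> n ?t = 1 \<and> L n ?t = \<kappa>"
        using hl[of "?t - real n"] hl[of "- ?t"] by (simp add: L_def \<eta>_def \<eta>1_def \<eta>2_def)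
      then have "N n x = \<kappa> powr p * D n x" using \<kappa>0 by (simp add: N D)
      then show ?thesis using R0 by simp
    next
      case 4
      have "norm x powr (- ?d) = exp (- ?d * ?t)" using False by (simp add: powr_def)
      also have "\<dots> \<le> exp (- (real n * ?d))" using 4 by (simp add: mult.commute)
      finally have "N n x \<le> exp (- (real n * ?d)) * M powr p" unfolding N using LMp by (intro mult_mono) auto
      moreover have "x \<in> cball 0 (exp (real n + 1))"
        using 4 nx[of "real n + 1"] by simp
      then have "exp (- (real n * ?d)) * M powr p \<le> R n x" by (simp add: R_def distrib_left mult.commute)
      ultimately have "N n x \<le> R n x" by linarith
      then show ?thesis using D0 by (simp add: add_increasing)
    qed
  qed
  have op: "open (UNIV - {0::'a})" by auto
  have intD: "integrable lborel (D n)" for n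
  proof -
    note C2' = C2c_facts[OF C2[of n] op]
    have "continuous_on (UNIV - {0}) (\<lambda>x. norm x powr (- ((2 - \<delta>) * p)) * \<bar>\<phi> n x\<bar> powr p)"
      using p by (intro continuous_on_mult continuous_on_powr' continuous_on_rabs C2'(4) continuous_intros) auto
    from borel_integrable_compact[OF C2'(1) continuous_on_subset[OF this C2'(2)]]
    have "integrable lborel (\<lambda>x. indicator (closure {x. \<phi> n x \<noteq> 0}) x * (norm x powr (- ((2 - \<delta>) * p)) * \<bar>\<phi> n x\<bar> powr p))"
      by simp
    moreover have "(\<lambda>x. indicator (closure {x. \<phi> n x \<noteq> 0}) x * (norm x powr (- ((2 - \<delta>) * p)) * \<bar>\<phi> n x\<bar> powr p)) = D n"
    proof
      fix x
      show "indicator (closure {x. \<phi> n x \<noteq> 0}) x * (norm x powr (- ((2 - \<delta>) * p)) * \<bar>\<phi> n x\<bar> powr p) = D n x"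
        using C2'(3)[of x] by (cases "x \<in> closure {x. \<phi> n x \<noteq> 0}"; cases "x = 0") (simp_all add: D_def)
    qed
    ultimately show ?thesis by simp
  qed
  have fin: "emeasure lborel (cball (0::'a) r) < \<infinity>" for r by (intro emeasure_bounded_finite) simp
  have intI: "integrable lborel (\<lambda>x. k * indicator (cball (0::'a) r) x)" for k r :: real
    using fin by (intro integrable_mult_right integrable_real_indicator) auto
  have intR: "integrable lborel (R n)" for n
    unfolding R_def[abs_def] by (intro integrable_mult_right Bochner_Integration.integrable_add intI)
  have LR: "(LINT x|lborel. R n x) = C" for n
  proof -
    have "(LINT x|lborel. R n x) = M powr p * (exp ?d * measure lborel (cball (0::'a) 1)
       + exp (- (real n * ?d)) * measure lborel (cball (0::'a) (exp (real n + 1))))"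
      unfolding R_def using fin
      by (subst integral_mult_right_zero, subst Bochner_Integration.integral_add[OF intI intI]) simp
    also have "\<dots> = M powr p * (exp ?d * unit_ball_vol ?d
       + exp (- (real n * ?d)) * (unit_ball_vol ?d * exp ((real n + 1) * ?d)))"
      by (simp add: measure_lborel_cball exp_of_nat2_mult[symmetric] del: content_cball)
    also have "exp (- (real n * ?d)) * (unit_ball_vol ?d * exp ((real n + 1) * ?d)) = unit_ball_vol ?d * exp ?d"
      by (simp add: exp_add[symmetric] algebra_simps)
    finally show ?thesis by (simp add: C_def algebra_simps)
  qed
  have up: "(LINT x|lborel. N n x) \<le> \<kappa> powr p * (LINT x|lborel. D n x) + C" for n
  proof -
    have "(LINT x|lborel. N n x) \<le> (LINT x|lborel. \<kappa> powr p * D n x + R n x)"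
    proof (rule integral_mono')
      show "integrable lborel (\<lambda>x. \<kappa> powr p * D n x + R n x)"
        by (intro Bochner_Integration.integrable_add integrable_mult_right intD intR)
      have "0 \<le> N n x" for x by (simp add: N_def)
      then show "0 \<le> \<kappa> powr p * D n x + R n x" for x using NDR order_trans by blast
    qed (rule NDR)
    also have "\<dots> = \<kappa> powr p * (LINT x|lborel. D n x) + C"
      using intD[of n] intR[of n] LR[of n] by simp
    finally show ?thesis .
  qed
  obtain c where c: "c > 0" and cI: "\<And>n. real n * c \<le>
    (LINT x|lborel. indicator (cball 0 (exp (real n)) - ball 0 1) x * norm (x::'a) powr (- ?d))"
  proof (rule shell_integral_lower_bound[where 'a = 'a], goal_cases)
    case (1 c) from 1(2-) show ?case by (rule 1(1))
  qed
  have low: "real n * c \<le> (LINT x|lborel. D n x)" for n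
  proof -
    have "indicator (cball 0 (exp (real n)) - ball 0 1) x * norm x powr (- ?d) \<le> D n x" for x :: 'a
    proof (cases "x \<in> cball 0 (exp (real n)) - ball 0 1")
      case True
      then have x: "x \<noteq> 0" "1 \<le> norm x" "norm x \<le> exp (real n)" by auto
      then have "0 \<le> ln (norm x)" "ln (norm x) \<le> real n"
        using ln_le_cancel_iff[of "norm x" "exp (real n)"] by (auto simp del: ln_le_cancel_iff)
      then have "\<eta> n (ln (norm x)) = 1"
        using hl[of "ln (norm x) - real n"] hl[of "- ln (norm x)"] by (simp add: \<eta>_def)
      then have "D n x = norm x powr (- ?d)" using den[OF x(1), of n] x by (simp add: D_def)
      then show ?thesis using True by simp
    qed (simp add: D_def)
    then have "(LINT x|lborel. indicator (cball 0 (exp (real n)) - ball 0 1) x * norm (x::'a) powr (- ?d)) \<le> (LINT x|lborel. D n x)"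
      by (rule integral_mono'[OF intD]) (auto simp: D_def)
    then show ?thesis using cI[of n] by linarith
  qed
  show ?thesis
    using that[of c C \<phi>] c C0 C2 up low
    unfolding set_lebesgue_integral_def N_def[abs_def] D_def[abs_def] by simp
qed

section \<open>The optimal constant\<close>

theorem proposition4p6:
  fixes \<Omega> :: "'a::euclidean_space set"
    and c_\<Omega> d_\<Gamma> :: "'a \<Rightarrow> real"
    and \<delta> p d :: real
  assumes d: "d = real DIM('a)"
    and \<Omega>: "\<Omega> = UNIV - {0}"
    and \<delta>: "0 \<le> \<delta>" "\<delta> < 2"
    and c: "c_\<Omega> = (\<lambda>x. norm x powr \<delta>)"
    and d_\<Gamma>: "d_\<Gamma> = (\<lambda>x. norm x)"
    and p: "p > 1" "d + p * \<delta> - 2 * p > 0"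
  shows "rellich_const p \<Omega> c_\<Omega> d_\<Gamma> = ((p - 1) * d * (d + p * \<delta> - 2 * p) / p^2) powr p"
proof -
  define m where "m = real DIM('a) - (2 - \<delta>) * p"
  define \<kappa> where "\<kappa> = (p - 1) * real DIM('a) * m / p\<^sup>2"
  have m0: "m > 0" and m': "d + p * \<delta> - 2 * p = m" using p by (simp_all add: m_def d algebra_simps)
  have \<kappa>0: "\<kappa> > 0" using p m0 by (simp add: \<kappa>_def)
  define N where "N \<phi> = (LINT x:UNIV - {0}|lborel. \<bar>div_op (\<lambda>x. norm x powr \<delta>) \<phi> x\<bar> powr p)" for \<phi> :: "'a \<Rightarrow> real"
  define D where "D \<phi> = (LINT x:UNIV - {0}|lborel. norm x powr (- ((2 - \<delta>) * p)) * \<bar>\<phi> x\<bar> powr p)" for \<phi> :: "'a \<Rightarrow> real"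
  define X where "X = {N \<phi> / D \<phi> | \<phi>. \<phi> \<in> C2c (UNIV - {0::'a}) \<and> \<phi> \<noteq> (\<lambda>x. 0)}"
  have w: "(norm x powr \<delta>) powr p * norm x powr (- 2 * p) = norm x powr (- ((2 - \<delta>) * p))" for x :: 'a
    by (simp add: powr_powr powr_add[symmetric] algebra_simps)
  have eq: "rellich_const p \<Omega> c_\<Omega> d_\<Gamma> = Inf X"
    unfolding rellich_const_def X_def N_def D_def \<Omega> c d_\<Gamma> w by simp
  have low: "\<kappa> powr p \<le> x" if "x \<in> X" for x
  proof -
    from that obtain \<phi> where \<phi>: "x = N \<phi> / D \<phi>" "\<phi> \<in> C2c (UNIV - {0::'a})" "\<phi> \<noteq> (\<lambda>x. 0)"
      by (auto simp: X_def)
    have "D \<phi> > 0" unfolding D_def using \<phi> p by (intro weighted_integral_pos) auto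
    moreover have "\<kappa> powr p * D \<phi> \<le> N \<phi>"
      unfolding N_def D_def using rellich_inequality[OF \<phi>(2) p(1) _ m_def m0 \<kappa>_def] \<delta> by simp
    ultimately show ?thesis by (simp add: \<phi>(1) pos_le_divide_eq)
  qed
  obtain \<psi> :: "nat \<Rightarrow> 'a \<Rightarrow> real" and C e where \<psi>: "e > 0" "C \<ge> 0" "\<And>n. \<psi> n \<in> C2c (UNIV - {0})"
    "\<And>n. N (\<psi> n) \<le> \<kappa> powr p * D (\<psi> n) + C" "\<And>n. real n * e \<le> D (\<psi> n)"
  proof (rule rellich_test_functions[where 'a = 'a, OF p(1) m_def \<kappa>_def less_imp_le[OF \<kappa>0], folded N_def D_def], goal_cases)
    case (1 \<phi> C c) from 1(2-) show ?case by (rule 1(1))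
  qed
  have bdd: "bdd_below X" using low by (rule bdd_belowI)
  have up: "Inf X \<le> \<kappa> powr p + C / (real (Suc n) * e)" for n
  proof -
    have ne: "real (Suc n) * e > 0" using \<psi>(1) by simp
    then have D: "D (\<psi> (Suc n)) > 0" using \<psi>(5)[of "Suc n"] by linarith
    then have "\<psi> (Suc n) \<noteq> (\<lambda>x. 0)" using p by (auto simp: D_def)
    then have "N (\<psi> (Suc n)) / D (\<psi> (Suc n)) \<in> X" using \<psi>(3) by (auto simp: X_def)
    then have "Inf X \<le> N (\<psi> (Suc n)) / D (\<psi> (Suc n))" using bdd by (rule cInf_lower)
    also have "\<dots> \<le> (\<kappa> powr p * D (\<psi> (Suc n)) + C) / D (\<psi> (Suc n))"
      using \<psi>(4) D by (intro divide_right_mono) auto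
    also have "\<dots> = \<kappa> powr p + C / D (\<psi> (Suc n))" using D by (simp add: field_simps)
    also have "\<dots> \<le> \<kappa> powr p + C / (real (Suc n) * e)"
      using \<psi>(2) \<psi>(5)[of "Suc n"] ne D by (intro add_left_mono divide_left_mono) auto
    finally show ?thesis .
  qed
  have "(\<lambda>n. \<kappa> powr p + C / e * inverse (real (Suc n))) \<longlonglongrightarrow> \<kappa> powr p + C / e * 0"
    by (intro tendsto_intros LIMSEQ_inverse_real_of_nat)
  then have "Inf X \<le> \<kappa> powr p"
    by (rule LIMSEQ_le_const[THEN order_trans]) (use up in \<open>auto simp: divide_inverse mult_ac\<close>)
  moreover have "X \<noteq> {}"
  proof -
    have "D (\<psi> 1) > 0" using \<psi>(1) \<psi>(5)[of 1] by simp
    then have "\<psi> 1 \<noteq> (\<lambda>x. 0)" using p by (auto simp: D_def)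
    then show ?thesis using \<psi>(3)[of 1] by (auto simp: X_def)
  qed
  then have "\<kappa> powr p \<le> Inf X" using low by (rule cInf_greatest)
  ultimately show ?thesis unfolding eq m' unfolding d \<kappa>_def[symmetric] by simp
qed

end
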